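(* Let $X$ be a (non-Euclidean) analytic normed plane and choose any non-zero point $z\in X$. Then there exists a unique map $R_z:X\to X$ with the following properties: (i) If $x$ does not lie on the line through $0,z$, then $R_z(x)$ is the unique point distinct from $x$ where $\|R_z(x)\|=\|x\|$ and $\|R_z(x)-z\|=\|x-z\|$. (ii) If $x$ does lie on the line through $0,z$, then $R_z(x)=x$. Furthermore, the map $R_z$ has the following properties: (1) $R_z$ is a homeomorphism. (2) $R_z$ is an analytic immersion on the set of points that do not lie on the line through $0,z$. (3) If $x\notin\operatorname{span}\{z\}$ then $R_z(x)$ does not lie in the same connected component of $X\setminus\operatorname{span}\{z\}$ as $x$. (4) If $x\in\operatorname{span}\{z\}$ and $y$ is a point where $\|y\|=\|x\|$ and $\|y-z\|=\|x-z\|$, then $y=x$.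
   Context: A normed plane is a $2$-dimensional real normed space. It is analytic if the restriction of its norm to $X\setminus\{0\}$ is a real analytic function (in linear coordinates), and non-Euclidean if its norm does not come from an inner product. Analyticity of maps between (open subsets of) normed spaces is understood after choosing bases. *)

theory Defs
  imports "HOL-Analysis.Analysis"
begin

(* Real analyticity for maps out of a finite-dimensional space.  A multi-index is an
   (extensional) function from the basis B to nat, and representation B v b is the b-coordinate
   of v.  The coefficients c are vectors of the target, so for a finite-dimensional target this
   says that all coordinate functions of f are analytic.  On an open set S this is the usual
   notion; values of f outside S are then irrelevant, since r can be decreased. *)
definition real_analytic_wrt ::
    "'a::real_normed_vector set \<Rightarrow> 'a set \<Rightarrow> ('a \<Rightarrow> 'b::real_normed_vector) \<Rightarrow> bool" where
  "real_analytic_wrt B S f \<longleftrightarrow>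
     (\<forall>p\<in>S. \<exists>r>0. \<exists>c :: ('a \<Rightarrow> nat) \<Rightarrow> 'b. \<forall>x\<in>ball p r.
        ((\<lambda>\<alpha>. (\<Prod>b\<in>B. representation B (x - p) b ^ \<alpha> b) *\<^sub>R c \<alpha>) has_sum f x)
          (B \<rightarrow>\<^sub>E UNIV))"

definition real_analytic_on ::
    "'a::real_normed_vector set \<Rightarrow> ('a \<Rightarrow> 'b::real_normed_vector) \<Rightarrow> bool" where
  "real_analytic_on S f \<longleftrightarrow>
     (\<exists>B. finite B \<and> independent B \<and> span B = UNIV \<and> real_analytic_wrt B S f)"

definition analytic_immersion_on ::
    "'a::real_normed_vector set \<Rightarrow> ('a \<Rightarrow> 'b::real_normed_vector) \<Rightarrow> bool" where
  "analytic_immersion_on S f \<longleftrightarrow>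
     real_analytic_on S f \<and> (\<forall>x\<in>S. \<exists>D. (f has_derivative D) (at x) \<and> inj D)"

definition comes_from_inner_product :: "('a::real_vector \<Rightarrow> real) \<Rightarrow> bool" where
  "comes_from_inner_product N \<longleftrightarrow>
     (\<exists>ip. bilinear ip \<and> (\<forall>x y. ip x y = ip y x) \<and> (\<forall>x. x \<noteq> 0 \<longrightarrow> ip x x > 0) \<and>
           (\<forall>x. N x = sqrt (ip x x)))"

definition norm_reflection :: "'a::real_normed_vector \<Rightarrow> ('a \<Rightarrow> 'a) \<Rightarrow> bool" where
  "norm_reflection z R \<longleftrightarrow>
     (\<forall>x. x \<notin> span {z} \<longrightarrow>
        (R x \<noteq> x \<and> norm (R x) = norm x \<and> norm (R x - z) = norm (x - z)) \<and>
        (\<forall>y. y \<noteq> x \<and> norm y = norm x \<and> norm (y - z) = norm (x - z) \<longrightarrow> y = R x)) \<and>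
     (\<forall>x. x \<in> span {z} \<longrightarrow> R x = x)"

end

theory Submission
  imports Defs "HOL-Complex_Analysis.Conformal_Mappings"
begin

text \<open>
  In a strictly convex plane the reflection is an elementary construction. Two spheres with distinct
  centres $0$ and $z$ have at most one common point on each side of the line through the centres,
  because two such points would give two triangles over the segment from $0$ to $z$ with equal side
  lengths, one contained in the other or with crossing sides, and the strict triangle inequality
  excludes both (\<open>same_side_unique\<close>). On the side that does not contain \<open>x\<close> such a
  point exists: along the half sphere from one end of the line to the other the distance to \<open>z\<close>
  runs from $|\,\|x\| - \|z\|\,|$ to $\|x\| + \|z\|$, and $\|x - z\|$ lies strictly between these
  (\<open>opposite_side_exists\<close>). On the line itself the strict triangle inequality leaves only \<open>x\<close>.
  Hence \<open>R\<close> exists, is unique, is an involution and exchanges the two sides. Its graph is described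
  by equations and one weak inequality between continuous functions (\<open>norm_reflection_graph\<close>), so it
  is closed, and compactness of bounded sets makes \<open>R\<close> continuous.
  
  An analytic norm is strictly convex: if the sphere contained a segment, the norm would be constant on
  a piece of a line avoiding the origin, hence constant on that whole line, although it is unbounded
  there (\<open>strict_triangle_analytic\<close>).
  
  For analyticity, near a point off the line \<open>R\<close> solves the two equations $\|R x\| = \|x\|$ and
  $\|R x - z\| = \|x - z\|$. The two differentials at \<open>R x\<close> are independent, since a common
  direction in which both spheres are flat would force \<open>R x\<close> and \<open>z\<close> to be collinear
  (\<open>spheres_transversal\<close>). The analytic inverse function theorem therefore applies. It is proved by
  passing to the complex domain: a function is real analytic at a point if and only if it extends
  to a continuous, separately holomorphic function of two complex variables. Such functions are
  continuously differentiable with complex linear derivative, so the real inverse function theorem on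
  $\mathbb{C}^2$ has a holomorphic inverse, and Cauchy's estimates turn the result back into a double
  power series. That the differential of \<open>R\<close> is injective then follows from $R \circ R = \mathrm{id}$.
\<close>

section \<open>Holomorphic functions of two complex variables\<close>

text \<open>
  Joint continuity is part of the notion: it makes Osgood's theorem (holomorphy in each variable
  implies a complex linear total derivative) a consequence of one-variable Cauchy estimates.
\<close>
definition holomorphic2_on :: "(complex \<times> complex \<Rightarrow> complex) \<Rightarrow> (complex \<times> complex) set \<Rightarrow> bool" where
  "holomorphic2_on f S \<longleftrightarrow> continuous_on S f \<and>
     (\<forall>p\<in>S. (\<lambda>z. f (z, snd p)) field_differentiable at (fst p) \<and>
             (\<lambda>w. f (fst p, w)) field_differentiable at (snd p))"

definition partial1 :: "(complex \<times> complex \<Rightarrow> complex) \<Rightarrow> complex \<times> complex \<Rightarrow> complex" where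
  "partial1 f p = deriv (\<lambda>z. f (z, snd p)) (fst p)"

definition partial2 :: "(complex \<times> complex \<Rightarrow> complex) \<Rightarrow> complex \<times> complex \<Rightarrow> complex" where
  "partial2 f p = deriv (\<lambda>w. f (fst p, w)) (snd p)"

lemma open_contains_polydisc:
  fixes p :: "complex \<times> complex"
  assumes "open S" "p \<in> S"
  obtains r where "r > 0" "cball (fst p) r \<times> cball (snd p) r \<subseteq> S"
proof -
  obtain A B where AB: "open A" "open B" "p \<in> A \<times> B" "A \<times> B \<subseteq> S"
    using assms by (rule open_prod_elim)
  obtain r1 where r1: "r1 > 0" "cball (fst p) r1 \<subseteq> A"
    using AB open_contains_cball by (metis mem_Times_iff)
  obtain r2 where r2: "r2 > 0" "cball (snd p) r2 \<subseteq> B"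
    using AB open_contains_cball by (metis mem_Times_iff)
  have "cball (fst p) (min r1 r2) \<times> cball (snd p) (min r1 r2) \<subseteq> S"
    using r1 r2 AB(4) by (force simp: subset_iff)
  then show thesis using that[of "min r1 r2"] r1 r2 by auto
qed

lemma holomorphic2_on_subset: "holomorphic2_on f S \<Longrightarrow> T \<subseteq> S \<Longrightarrow> holomorphic2_on f T"
  unfolding holomorphic2_on_def using continuous_on_subset by blast

lemma holomorphic2_on_swap:
  assumes "holomorphic2_on f S"
  shows "holomorphic2_on (f \<circ> prod.swap) (prod.swap ` S)"
proof -
  have "continuous_on (prod.swap ` S) (f \<circ> prod.swap)"
    using assms unfolding holomorphic2_on_def
    by (intro continuous_on_compose continuous_on_swap) (auto simp: image_image)
  then show ?thesis using assms unfolding holomorphic2_on_def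
    by (auto simp: field_differentiable_def)
qed

text \<open>
  Translating one of two nearby points onto the other turns the difference of the partial derivatives
  into the derivative of a single one-variable function, which is small by uniform continuity of \<open>f\<close>.
  Cauchy's inequality for a fixed radius bounds its derivative.
\<close>
lemma continuous_on_partial2:
  assumes f: "holomorphic2_on f S" and S: "open S"
  shows "continuous_on S (partial2 f)"
proof -
  have "\<exists>d>0. \<forall>p\<in>S. dist p p0 < d \<longrightarrow> dist (partial2 f p) (partial2 f p0) < e" if p0: "p0 \<in> S" and e: "e > 0" for p0 e
  proof -
    obtain z0 w0 where p0_eq: "p0 = (z0, w0)" by fastforce
    obtain r' where r': "r' > 0" "cball z0 r' \<times> cball w0 r' \<subseteq> S"
      using open_contains_polydisc[OF S p0] unfolding p0_eq by auto
    define r where "r = r' / 2"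
    have r: "r > 0" "r' = 2 * r" using r' by (auto simp: r_def)
    define K where "K = cball z0 r' \<times> cball w0 r'"
    have KS: "K \<subseteq> S" using r' K_def by blast
    have "compact K" unfolding K_def by (intro compact_Times) auto
    moreover have "continuous_on K f" using f KS unfolding holomorphic2_on_def
      using continuous_on_subset by blast
    ultimately have "uniformly_continuous_on K f" by (rule compact_uniformly_continuous[rotated])
    then obtain d where d: "d > 0" "\<And>p q. p \<in> K \<Longrightarrow> q \<in> K \<Longrightarrow> dist q p < d \<Longrightarrow> dist (f q) (f p) < e * r / 2"
      unfolding uniformly_continuous_on_def using e r by (metis half_gt_zero mult_pos_pos)
    show ?thesis
    proof (intro exI[of _ "min d r"] conjI ballI impI)
      show "min d r > 0" using d r by auto
    next
      fix p assume pS: "p \<in> S" and dist: "dist p p0 < min d r"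
      obtain z w where p: "p = (z, w)" by fastforce
      have zz: "dist z z0 < r" "dist w w0 < r"
        using dist dist_fst_le[of p p0] dist_snd_le[of p p0] unfolding p p0_eq by auto
      \<comment> \<open>the derivative of \<open>k\<close> at \<open>w0\<close> is the difference of the two partial derivatives\<close>
      define k where "k = (\<lambda>v. f (z, v + (w - w0)) - f (z0, v))"
      have inK1: "(z, v + (w - w0)) \<in> K" if "dist w0 v \<le> r" for v
      proof -
        have "dist w0 (v + (w - w0)) \<le> dist w0 v + dist w w0"
          by (smt (verit, best) dist_commute dist_norm dist_triangle add_diff_cancel_left')
        then show ?thesis using that zz r unfolding K_def by (auto simp: dist_commute)
      qed
      have inK2: "(z0, v) \<in> K" if "dist w0 v \<le> r" for v
        using that r unfolding K_def by auto
      have d1: "((\<lambda>v. f (z, v + (w - w0))) has_field_derivative partial2 f (z, v + (w - w0))) (at v)"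
        if "dist w0 v \<le> r" for v
      proof -
        have "((\<lambda>u. f (z, u)) has_field_derivative partial2 f (z, v + (w - w0))) (at (v + (w - w0)))"
          using f inK1[OF that] KS unfolding holomorphic2_on_def partial2_def
          by (metis DERIV_deriv_iff_field_differentiable fst_conv snd_conv subsetD)
        then show ?thesis by (subst (asm) DERIV_shift)
      qed
      have d2: "((\<lambda>v. f (z0, v)) has_field_derivative partial2 f (z0, v)) (at v)"
        if "dist w0 v \<le> r" for v
        using f inK2[OF that] KS unfolding holomorphic2_on_def partial2_def
        by (metis DERIV_deriv_iff_field_differentiable fst_conv snd_conv subsetD)
      have dk: "(k has_field_derivative partial2 f (z, v + (w - w0)) - partial2 f (z0, v)) (at v)"
        if "dist w0 v \<le> r" for v
        unfolding k_def by (intro DERIV_diff d1 d2 that)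
      have "norm ((deriv ^^ 1) k w0) \<le> fact 1 * (e * r / 2) / r ^ 1"
      proof (rule Cauchy_inequality)
        show "k holomorphic_on ball w0 r"
          unfolding holomorphic_on_def
          using dk by (auto simp: field_differentiable_def intro: has_field_derivative_at_within) (meson less_imp_le has_field_derivative_at_within)
        show "continuous_on (cball w0 r) k"
          using dk by (auto intro!: continuous_at_imp_continuous_on DERIV_isCont)
        fix v assume v: "norm (w0 - v) = r"
        then have v': "dist w0 v \<le> r" by (simp add: dist_norm)
        have "dist (z, v + (w - w0)) (z0, v) = dist p p0"
          unfolding p p0_eq by (simp add: dist_Pair_Pair) (simp add: dist_norm)
        then have "dist (f (z, v + (w - w0))) (f (z0, v)) < e * r / 2"
          using d(2) inK1[OF v'] inK2[OF v'] dist by auto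
        then show "norm (k v) \<le> e * r / 2" unfolding k_def by (simp add: dist_norm)
      qed (use r in auto)
      moreover have "deriv k w0 = partial2 f p - partial2 f p0"
        using DERIV_imp_deriv[OF dk[of w0]] r unfolding p p0_eq by auto
      ultimately show "dist (partial2 f p) (partial2 f p0) < e"
        using r e by (simp add: dist_norm)
    qed
  qed
  then show ?thesis unfolding continuous_on_iff by blast
qed

lemma continuous_on_partial1:
  assumes f: "holomorphic2_on f S" and S: "open S"
  shows "continuous_on S (partial1 f)"
proof -
  have "prod.swap ` S = prod.swap -` S" by force
  then have "open (prod.swap ` S)"
    using open_vimage[OF S continuous_on_swap[of UNIV]] by simp
  then have "continuous_on (prod.swap ` S) (partial2 (f \<circ> prod.swap))"
    by (intro continuous_on_partial2 holomorphic2_on_swap f)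
  then have "continuous_on S (partial2 (f \<circ> prod.swap) \<circ> prod.swap)"
    by (intro continuous_on_compose continuous_on_swap)
  moreover have "partial2 (f \<circ> prod.swap) \<circ> prod.swap = partial1 f"
    by (auto simp: partial1_def partial2_def o_def)
  ultimately show ?thesis by simp
qed

text \<open>
  Osgood's lemma: one partial derivative that is jointly continuous, together with the mere existence
  of the other one, yields the total derivative.
\<close>
lemma has_derivative_partials:
  assumes f: "holomorphic2_on f S" and S: "open S" and p: "p \<in> S"
  shows "(f has_derivative (\<lambda>h. partial1 f p * fst h + partial2 f p * snd h)) (at p)"
proof -
  obtain z w where pz: "p = (z, w)" by fastforce
  obtain r where r: "r > 0" "cball z r \<times> cball w r \<subseteq> S"
    using open_contains_polydisc[OF S p] unfolding pz by auto
  have sub: "ball z r \<times> ball w r \<subseteq> S" using r by (force simp: subset_iff)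
  have "((\<lambda>(x, y). f (x, y)) has_derivative
      (\<lambda>(tx, ty). (partial1 f p * tx) + blinfun_apply (blinfun_mult_right (partial2 f (z, w))) ty))
      (at (z, w) within ball z r \<times> ball w r)"
  proof (rule has_derivative_partialsI[where fy = "\<lambda>x y. blinfun_mult_right (partial2 f (x, y))"])
    have "((\<lambda>x. f (x, w)) has_field_derivative partial1 f p) (at z)"
      using f p unfolding holomorphic2_on_def partial1_def pz
      by (metis DERIV_deriv_iff_field_differentiable fst_conv snd_conv)
    then show "((\<lambda>x. f (x, w)) has_derivative (*) (partial1 f p)) (at z within ball z r)"
      by (metis has_field_derivative_def has_derivative_at_withinI)
  next
    fix x y assume "x \<in> ball z r" "y \<in> ball w r"
    then have "(x, y) \<in> S" using sub by auto
    then have "((\<lambda>v. f (x, v)) has_field_derivative partial2 f (x, y)) (at y)"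
      using f unfolding holomorphic2_on_def partial2_def
      by (metis DERIV_deriv_iff_field_differentiable fst_conv snd_conv)
    then show "((\<lambda>v. f (x, v)) has_derivative blinfun_apply (blinfun_mult_right (partial2 f (x, y)))) (at y within ball w r)"
      by (simp add: has_field_derivative_def has_derivative_at_withinI)
  next
    have "continuous_on S (\<lambda>p. blinfun_mult_right (partial2 f p))"
      using continuous_on_partial2[OF f S] by (intro continuous_intros)
    then have "continuous (at p within S) (\<lambda>p. blinfun_mult_right (partial2 f p))"
      using p continuous_on_eq_continuous_within by blast
    then show "continuous (at (z, w) within ball z r \<times> ball w r) (\<lambda>(x, y). blinfun_mult_right (partial2 f (x, y)))"
      unfolding pz by (simp add: case_prod_unfold) (rule continuous_within_subset[OF _ sub])
  qed (use r in auto)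
  moreover have "at (z, w) within ball z r \<times> ball w r = at (z, w)"
    using r by (intro at_within_open open_Times) auto
  ultimately show ?thesis unfolding pz by (simp add: case_prod_unfold)
qed

lemma holomorphic2_onI_has_derivative:
  assumes "\<And>p. p \<in> S \<Longrightarrow> (f has_derivative (\<lambda>h. a p * fst h + b p * snd h)) (at p)"
  shows "holomorphic2_on f S"
  unfolding holomorphic2_on_def
proof (intro conjI ballI)
  show "continuous_on S f"
    using assms by (intro continuous_at_imp_continuous_on ballI has_derivative_continuous)
  fix p assume "p \<in> S"
  then have f: "(f has_derivative (\<lambda>h. a p * fst h + b p * snd h)) (at (fst p, snd p))"
    using assms by simp
  have "((\<lambda>z. (z, snd p)) has_derivative (\<lambda>h. (h, 0))) (at (fst p))"
    by (intro derivative_intros)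
  from has_derivative_compose[OF this f]
  show "(\<lambda>z. f (z, snd p)) field_differentiable at (fst p)"
    unfolding field_differentiable_def has_field_derivative_def by auto
  have "((\<lambda>z. (fst p, z)) has_derivative (\<lambda>h. (0, h))) (at (snd p))"
    by (intro derivative_intros)
  from has_derivative_compose[OF this f]
  show "(\<lambda>z. f (fst p, z)) field_differentiable at (snd p)"
    unfolding field_differentiable_def has_field_derivative_def by auto
qed

lemma holomorphic2_on_compose:
  assumes f: "holomorphic2_on f S" and g: "holomorphic2_on g S" and h: "holomorphic2_on h T"
    and S: "open S" and T: "open T" and sub: "\<And>p. p \<in> S \<Longrightarrow> (f p, g p) \<in> T"
  shows "holomorphic2_on (\<lambda>p. h (f p, g p)) S"
proof (rule holomorphic2_onI_has_derivative)
  fix p assume p: "p \<in> S"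
  note df = has_derivative_partials[OF f S p] and dg = has_derivative_partials[OF g S p]
    and dh = has_derivative_partials[OF h T sub[OF p]]
  have "((\<lambda>p. h (f p, g p)) has_derivative
     (\<lambda>v. (\<lambda>u. partial1 h (f p, g p) * fst u + partial2 h (f p, g p) * snd u)
        (partial1 f p * fst v + partial2 f p * snd v, partial1 g p * fst v + partial2 g p * snd v))) (at p)"
    by (rule has_derivative_compose[OF has_derivative_Pair[OF df dg] dh])
  moreover have "(\<lambda>v. (\<lambda>u. partial1 h (f p, g p) * fst u + partial2 h (f p, g p) * snd u)
        (partial1 f p * fst v + partial2 f p * snd v, partial1 g p * fst v + partial2 g p * snd v))
     = (\<lambda>v. (partial1 h (f p, g p) * partial1 f p + partial2 h (f p, g p) * partial1 g p) * fst v
          + (partial1 h (f p, g p) * partial2 f p + partial2 h (f p, g p) * partial2 g p) * snd v)"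
    by (auto simp: algebra_simps)
  ultimately show "((\<lambda>p. h (f p, g p)) has_derivative
     (\<lambda>v. (partial1 h (f p, g p) * partial1 f p + partial2 h (f p, g p) * partial1 g p) * fst v
          + (partial1 h (f p, g p) * partial2 f p + partial2 h (f p, g p) * partial2 g p) * snd v)) (at p)"
    by simp
qed

section \<open>Double power series\<close>

text \<open>
  Expand first in \<open>z\<close>, with coefficients \<open>\<beta> m w\<close>, and then each coefficient in \<open>w\<close>. The
  coefficients are holomorphic in \<open>w\<close> without any differentiation under an integral: by induction on
  \<open>m\<close>, \<open>\<beta> m\<close> is a uniform limit of the holomorphic remainder quotients
  $(f(a + t, w) - \sum_{k < m} \beta_k(w) t^k) / t^m$ as $t \to 0$. Cauchy's inequality in each variable
  bounds the double coefficients geometrically, so the series converges absolutely.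
\<close>
lemma holomorphic2_power_series:
  assumes f: "holomorphic2_on f S" and S: "open S" and p: "p \<in> S"
  obtains r c where "r > 0"
    "\<And>z w. norm z < r \<Longrightarrow> norm w < r \<Longrightarrow>
       ((\<lambda>(m, n). c m n * z ^ m * w ^ n) has_sum f (fst p + z, snd p + w)) UNIV"
proof -
  obtain a b where pab: "p = (a, b)" by fastforce
  obtain R where R: "R > 0" "cball a R \<times> cball b R \<subseteq> S"
    using open_contains_polydisc[OF S p] unfolding pab by auto
  have contf: "continuous_on (cball a R \<times> cball b R) f"
    using f R(2) unfolding holomorphic2_on_def using continuous_on_subset by blast
  then have "compact (f ` (cball a R \<times> cball b R))"
    by (intro compact_continuous_image compact_Times compact_cball)
  then obtain M where M: "\<And>z w. z \<in> cball a R \<Longrightarrow> w \<in> cball b R \<Longrightarrow> norm (f (z, w)) \<le> M"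
    using compact_imp_bounded bounded_iff by (metis (no_types, lifting) SigmaI image_eqI)
  have M0: "M \<ge> 0" using M[of a b] R by (metis centre_in_cball less_imp_le norm_ge_zero order_trans)
  have fz: "(\<lambda>z. f (z, w)) field_differentiable at z" if "z \<in> cball a R" "w \<in> cball b R" for z w
    using f R(2) that unfolding holomorphic2_on_def by fastforce
  have fw: "(\<lambda>w. f (z, w)) field_differentiable at w" if "z \<in> cball a R" "w \<in> cball b R" for z w
    using f R(2) that unfolding holomorphic2_on_def by fastforce
  define \<beta> where "\<beta> m w = (deriv ^^ m) (\<lambda>z. f (z, w)) a / fact m" for m w
  have holz: "(\<lambda>z. f (z, w)) holomorphic_on cball a R" if "w \<in> cball b R" for w
    using fz that by (auto simp: holomorphic_on_def field_differentiable_at_within)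
  have \<beta>_bound: "norm (\<beta> m w) \<le> M / R ^ m" if w: "w \<in> cball b R" for m w
  proof -
    have "norm ((deriv ^^ m) (\<lambda>z. f (z, w)) a) \<le> fact m * M / R ^ m"
    proof (rule Cauchy_inequality)
      show "(\<lambda>z. f (z, w)) holomorphic_on ball a R" "continuous_on (cball a R) (\<lambda>z. f (z, w))"
        using holz[OF w] holomorphic_on_subset[OF _ ball_subset_cball] holomorphic_on_imp_continuous_on by blast+
      show "norm (f (x, w)) \<le> M" if "norm (a - x) = R" for x
        using M w that by (simp add: dist_norm)
    qed (use R in auto)
    then show ?thesis unfolding \<beta>_def using R by (simp add: norm_divide field_simps)
  qed
  have \<beta>_sums: "(\<lambda>m. \<beta> m w * (z - a) ^ m) sums f (z, w)" if "z \<in> ball a R" "w \<in> cball b R" for z w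
    unfolding \<beta>_def
    by (rule holomorphic_power_series[OF holomorphic_on_subset[OF holz ball_subset_cball]]) (use that in auto)
  have \<beta>_hol: "\<beta> m holomorphic_on ball b R" for m
  proof (induction m rule: less_induct)
    case (less m)
    \<comment> \<open>with the ratio \<open>q = 1 / (j + 2)\<close> the geometric tail \<open>q / (1 - q)\<close> is exactly \<open>1 / (j + 1)\<close>\<close>
    define t :: "nat \<Rightarrow> complex" where "t j = complex_of_real (R / (j + 2))" for j
    have nt: "norm (t j) = R / (j + 2)" for j unfolding t_def norm_of_real using R by (simp add: abs_div)
    have t0: "t j \<noteq> 0" for j using nt[of j] R by auto
    define h where "h j w = (f (a + t j, w) - (\<Sum>k<m. \<beta> k w * t j ^ k)) / t j ^ m" for j w
    have ta: "a + t j \<in> ball a R" for j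
      using R by (simp add: dist_norm nt field_simps add_pos_nonneg)
    have hh: "norm (h j w - \<beta> m w) \<le> M / R ^ m / (j + 1)" if w: "w \<in> ball b R" for j w
    proof -
      define q :: real where "q = 1 / (j + 2)"
      have q: "0 < q" "q < 1" unfolding q_def by auto
      have "(\<lambda>k. \<beta> k w * t j ^ k) sums f (a + t j, w)"
        using \<beta>_sums[OF ta[of j], of w] w by simp
      then have 1: "(\<lambda>k. \<beta> (k + Suc m) w * t j ^ (k + Suc m)) sums (f (a + t j, w) - (\<Sum>k<Suc m. \<beta> k w * t j ^ k))"
        by (rule sums_split_initial_segment)
      have "(\<lambda>k. M * q ^ Suc m * q ^ k) sums (M * q ^ Suc m * (1 / (1 - q)))"
        using q by (intro sums_mult geometric_sums) auto
      with 1 have "norm (f (a + t j, w) - (\<Sum>k<Suc m. \<beta> k w * t j ^ k)) \<le> M * q ^ Suc m * (1 / (1 - q))"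
      proof (rule norm_sums_le)
        fix k
        have "norm (\<beta> (k + Suc m) w * t j ^ (k + Suc m)) \<le> M / R ^ (k + Suc m) * (R * q) ^ (k + Suc m)"
          unfolding norm_mult norm_power nt using \<beta>_bound[of w "k + Suc m"] w R M0
          by (intro mult_mono) (auto simp: q_def)
        also have "\<dots> = M * q ^ Suc m * q ^ k" using R by (simp add: power_mult_distrib power_add field_simps)
        finally show "norm (\<beta> (k + Suc m) w * t j ^ (k + Suc m)) \<le> M * q ^ Suc m * q ^ k" .
      qed
      also have "1 - q = (j + 1) * q"
        unfolding q_def by (simp add: field_simps)
      then have "M * q ^ Suc m * (1 / (1 - q)) = M * q ^ m / (j + 1)"
        using q by simp
      finally have 2: "norm (f (a + t j, w) - (\<Sum>k<Suc m. \<beta> k w * t j ^ k)) \<le> M * q ^ m / (j + 1)" .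
      have "h j w - \<beta> m w = (f (a + t j, w) - (\<Sum>k<Suc m. \<beta> k w * t j ^ k)) / t j ^ m"
        unfolding h_def using t0[of j] by (simp add: field_simps)
      then have "norm (h j w - \<beta> m w) = norm (f (a + t j, w) - (\<Sum>k<Suc m. \<beta> k w * t j ^ k)) / (R * q) ^ m"
        by (simp add: norm_divide norm_power nt q_def)
      also have "\<dots> \<le> (M * q ^ m / (j + 1)) / (R * q) ^ m"
        using 2 R q by (intro divide_right_mono) auto
      also have "\<dots> = M / R ^ m / (j + 1)" using q R by (simp add: power_mult_distrib mult_ac)
      finally show ?thesis .
    qed
    show ?case
    proof (rule holomorphic_uniform_sequence[of _ h])
      show "h j holomorphic_on ball b R" for j
      proof -
        have "(\<lambda>w. f (a + t j, w)) holomorphic_on ball b R"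
          using fw ta[of j] by (auto simp: holomorphic_on_def field_differentiable_at_within)
        then show ?thesis unfolding h_def using less.IH t0[of j]
          by (intro holomorphic_intros) auto
      qed
      fix w assume w: "w \<in> ball b R"
      obtain d where d: "d > 0" "cball w d \<subseteq> ball b R"
        using w open_contains_cball open_ball by blast
      have "(\<lambda>j. M / R ^ m / real (j + 1)) \<longlonglongrightarrow> 0"
        using lim_const_over_n[THEN LIMSEQ_Suc, of "M / R ^ m"] by (simp add: add.commute)
      then have small: "\<forall>\<^sub>F j in sequentially. M / R ^ m / real (j + 1) < e" if "e > 0" for e
        using order_tendstoD(2) that by blast
      have "uniform_limit (cball w d) h (\<beta> m) sequentially"
      proof (rule uniform_limitI)
        fix e :: real assume "e > 0"
        from small[OF this] show "\<forall>\<^sub>F j in sequentially. \<forall>x\<in>cball w d. dist (h j x) (\<beta> m x) < e"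
        proof (rule eventually_mono, intro ballI)
          fix j x assume j: "M / R ^ m / real (j + 1) < e" and "x \<in> cball w d"
          then have "norm (h j x - \<beta> m x) \<le> M / R ^ m / real (j + 1)" using hh[of x j] d(2) by auto
          with j show "dist (h j x) (\<beta> m x) < e" unfolding dist_norm by linarith
        qed
      qed
      then show "\<exists>d>0. cball w d \<subseteq> ball b R \<and> uniform_limit (cball w d) h (\<beta> m) sequentially"
        using d by blast
    qed auto
  qed
  \<comment> \<open>\<open>\<beta> m\<close> is only known to be holomorphic on the open disc, so its Cauchy estimate uses a smaller radius\<close>
  define r where "r = R / 2"
  have r: "r > 0" "r < R" using R by (auto simp: r_def)
  define c where "c m n = (deriv ^^ n) (\<beta> m) b / fact n" for m n
  have c_bound: "norm (c m n) \<le> M / r ^ m / r ^ n" for m n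
  proof -
    have sub: "cball b r \<subseteq> ball b R" using r by auto
    have Mr: "M / R ^ m \<le> M / r ^ m" using M0 r by (intro divide_left_mono power_mono) auto
    have "norm ((deriv ^^ n) (\<beta> m) b) \<le> fact n * (M / r ^ m) / r ^ n"
    proof (rule Cauchy_inequality)
      have "\<beta> m holomorphic_on cball b r" by (rule holomorphic_on_subset[OF \<beta>_hol sub])
      then show "\<beta> m holomorphic_on ball b r" "continuous_on (cball b r) (\<beta> m)"
        by (rule holomorphic_on_subset[OF _ ball_subset_cball], rule holomorphic_on_imp_continuous_on)
      show "norm (\<beta> m x) \<le> M / r ^ m" if "norm (b - x) = r" for x
        using \<beta>_bound[of x m] that r Mr by (force simp: dist_norm)
    qed (use r in auto)
    then show ?thesis unfolding c_def using r by (simp add: norm_divide field_simps)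
  qed
  show thesis
  proof (rule that[of r c])
    fix z w :: complex assume z: "norm z < r" and w: "norm w < r"
    define x y where "x = norm z / r" and "y = norm w / r"
    have xy: "0 \<le> x" "x < 1" "0 \<le> y" "y < 1" using z w r unfolding x_def y_def by auto
    have le: "norm (c m n * z ^ m * w ^ n) \<le> M * x ^ m * y ^ n" for m n
    proof -
      have "norm (c m n * z ^ m * w ^ n) \<le> M / r ^ m / r ^ n * norm z ^ m * norm w ^ n"
        unfolding norm_mult norm_power by (intro mult_right_mono c_bound) auto
      then show ?thesis unfolding x_def y_def by (simp add: power_divide field_simps)
    qed
    have geo: "((\<lambda>n. s * t ^ n) has_sum s / (1 - t)) UNIV" if "0 \<le> t" "t < 1" "0 \<le> s" for s t :: real
    proof -
      have "(\<lambda>n. s * t ^ n) sums (s * (1 / (1 - t)))" using that by (intro sums_mult geometric_sums) auto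
      then show ?thesis using that by (intro sums_nonneg_imp_has_sum) auto
    qed
    have geo2: "(\<lambda>(m, n). M * x ^ m * y ^ n) summable_on UNIV \<times> UNIV"
    proof (rule summable_on_SigmaI)
      show "((\<lambda>n. case (m, n) of (m, n) \<Rightarrow> M * x ^ m * y ^ n) has_sum M * x ^ m / (1 - y)) UNIV" for m
        using geo[of y "M * x ^ m"] xy M0 by simp
      have "((\<lambda>m. M / (1 - y) * x ^ m) has_sum M / (1 - y) / (1 - x)) UNIV"
        using xy M0 by (intro geo) auto
      then show "(\<lambda>m. M * x ^ m / (1 - y)) summable_on UNIV"
        using has_sum_imp_summable by fastforce
    qed (use M0 xy in auto)
    have summ: "(\<lambda>(m, n). c m n * z ^ m * w ^ n) summable_on UNIV \<times> UNIV"
      by (rule abs_summable_summable, rule Infinite_Sum.abs_summable_on_comparison_test'[OF geo2])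
         (use le in auto)
    have "((\<lambda>(m, n). c m n * z ^ m * w ^ n) has_sum f (fst p + z, snd p + w)) (UNIV \<times> UNIV)"
    proof (rule has_sum_SigmaI[OF _ _ summ])
      fix m
      have "(\<lambda>n. c m n * w ^ n) sums \<beta> m (b + w)"
        using holomorphic_power_series[OF \<beta>_hol[of m], of "b + w"] w r
        unfolding c_def by (simp add: dist_norm)
      then have "(\<lambda>n. c m n * z ^ m * w ^ n) sums (\<beta> m (b + w) * z ^ m)"
        by (drule_tac c = "z ^ m" in sums_mult2) (simp add: mult_ac)
      moreover have "summable (\<lambda>n. norm (c m n * z ^ m * w ^ n))"
        by (rule summable_comparison_test'[where g = "\<lambda>n. M * x ^ m * y ^ n"])
           (use le xy in \<open>auto intro!: summable_mult summable_geometric\<close>)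
      ultimately show "((\<lambda>n. case (m, n) of (m, n) \<Rightarrow> c m n * z ^ m * w ^ n) has_sum \<beta> m (b + w) * z ^ m) UNIV"
        by (simp add: norm_summable_imp_has_sum)
    next
      have bw: "b + w \<in> cball b R" using w r by (simp add: dist_norm)
      have "(\<lambda>m. \<beta> m (b + w) * z ^ m) sums f (a + z, b + w)"
        using \<beta>_sums[of "a + z" "b + w"] bw z r by (simp add: dist_norm)
      moreover have "summable (\<lambda>m. norm (\<beta> m (b + w) * z ^ m))"
      proof (rule summable_comparison_test'[where g = "\<lambda>m. M * x ^ m"])
        show "summable (\<lambda>m. M * x ^ m)" using xy by (auto intro!: summable_mult summable_geometric)
        fix m
        have "norm (\<beta> m (b + w) * z ^ m) \<le> M / R ^ m * norm z ^ m"
          unfolding norm_mult norm_power by (intro mult_right_mono \<beta>_bound bw) auto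
        also have "\<dots> \<le> M / r ^ m * norm z ^ m"
          using M0 r by (intro mult_right_mono divide_left_mono power_mono) auto
        also have "\<dots> = M * x ^ m" unfolding x_def by (simp add: power_divide)
        finally show "norm (norm (\<beta> m (b + w) * z ^ m)) \<le> M * x ^ m" by simp
      qed
      ultimately show "((\<lambda>m. \<beta> m (b + w) * z ^ m) has_sum f (fst p + z, snd p + w)) UNIV"
        unfolding pab by (simp add: norm_summable_imp_has_sum)
    qed
    then show "((\<lambda>(m, n). c m n * z ^ m * w ^ n) has_sum f (fst p + z, snd p + w)) UNIV"
      by simp
  qed (use r in auto)
qed

text \<open>
  The M-test on the closed polydisc makes the sum a uniform limit of polynomials, jointly and in each
  variable separately, and both continuity and holomorphy pass to uniform limits.
\<close>
lemma power_series_holomorphic2: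
  fixes c :: "nat \<Rightarrow> nat \<Rightarrow> complex"
  assumes summ: "(\<lambda>(m, n). norm (c m n) * r ^ m * r ^ n) summable_on UNIV"
  shows "holomorphic2_on (\<lambda>p. \<Sum>\<^sub>\<infinity>(m, n). c m n * (fst p - a) ^ m * (snd p - b) ^ n)
            (ball a r \<times> ball b r)" (is "holomorphic2_on ?f _")
proof -
  define T where "T p k = c (fst k) (snd k) * (fst p - a) ^ fst k * (snd p - b) ^ snd k" for p k
  have f: "?f = (\<lambda>p. \<Sum>\<^sub>\<infinity>k. T p k)" unfolding T_def by (simp add: case_prod_unfold)
  have f': "?f (z, w) = (\<Sum>\<^sub>\<infinity>k. T (z, w) k)" for z w unfolding T_def by (simp add: case_prod_unfold)
  have le: "norm (T p k) \<le> (\<lambda>(m, n). norm (c m n) * r ^ m * r ^ n) k" if "p \<in> cball a r \<times> cball b r" for p k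
  proof -
    have "norm (fst p - a) \<le> r" "norm (snd p - b) \<le> r"
      using that by (auto simp: dist_norm norm_minus_commute)
    moreover from this have "r \<ge> 0" using norm_ge_zero order_trans by blast
    ultimately show ?thesis unfolding T_def norm_mult norm_power case_prod_unfold
      by (intro mult_mono power_mono) auto
  qed
  have ul: "uniform_limit (cball a r \<times> cball b r) (\<lambda>F p. \<Sum>k\<in>F. T p k) (\<lambda>p. \<Sum>\<^sub>\<infinity>k. T p k) (finite_subsets_at_top UNIV)"
    by (rule Weierstrass_m_test_general[OF le summ])
  have cont: "continuous_on (cball a r \<times> cball b r) ?f" unfolding f
    by (rule uniform_limit_theorem[OF _ ul])
       (auto simp: T_def intro!: always_eventually continuous_intros)
  have hz: "(\<lambda>z. ?f (z, w)) holomorphic_on ball a r" if "w \<in> cball b r" for w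
  proof (rule holomorphic_uniform_limit[where F = "finite_subsets_at_top UNIV"])
    show "uniform_limit (cball a r) (\<lambda>F z. \<Sum>k\<in>F. T (z, w) k) (\<lambda>z. ?f (z, w)) (finite_subsets_at_top UNIV)"
      unfolding f' by (rule Weierstrass_m_test_general[OF le summ]) (use that in auto)
  qed (auto simp: T_def intro!: always_eventually continuous_intros holomorphic_intros)
  have hw: "(\<lambda>w. ?f (z, w)) holomorphic_on ball b r" if "z \<in> cball a r" for z
  proof (rule holomorphic_uniform_limit[where F = "finite_subsets_at_top UNIV"])
    show "uniform_limit (cball b r) (\<lambda>F w. \<Sum>k\<in>F. T (z, w) k) (\<lambda>w. ?f (z, w)) (finite_subsets_at_top UNIV)"
      unfolding f' by (rule Weierstrass_m_test_general[OF le summ]) (use that in auto)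
  qed (auto simp: T_def intro!: always_eventually continuous_intros holomorphic_intros)
  show ?thesis unfolding holomorphic2_on_def
  proof (intro conjI ballI)
    show "continuous_on (ball a r \<times> ball b r) ?f"
      by (rule continuous_on_subset[OF cont]) auto
    fix p assume p: "p \<in> ball a r \<times> ball b r"
    show "(\<lambda>z. ?f (z, snd p)) field_differentiable at (fst p)"
      using hz[of "snd p"] p holomorphic_on_imp_differentiable_at[of _ "ball a r" "fst p"] by auto
    show "(\<lambda>w. ?f (fst p, w)) field_differentiable at (snd p)"
      using hw[of "fst p"] p holomorphic_on_imp_differentiable_at[of _ "ball b r" "snd p"] by auto
  qed
qed

section \<open>The inverse function theorem in two complex variables\<close>

text \<open>
  The inverse function theorem for the underlying real space applies because the partial derivatives
  are continuous. The derivative of the inverse is the inverse of a complex linear map, hence complex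
  linear, so the inverse is again holomorphic.
\<close>
lemma holomorphic2_inverse_function:
  assumes f: "holomorphic2_on f S" and g: "holomorphic2_on g S" and S: "open S" and p: "p \<in> S"
    and det: "partial1 f p * partial2 g p - partial2 f p * partial1 g p \<noteq> 0"
  obtains U V h k where "open U" "p \<in> U" "U \<subseteq> S" "open V" "holomorphic2_on h V" "holomorphic2_on k V"
    "\<And>q. q \<in> U \<Longrightarrow> (f q, g q) \<in> V \<and> (h (f q, g q), k (f q, g q)) = q"
proof -
  define L where "L x = (\<lambda>v::complex \<times> complex. (partial1 f x * fst v + partial2 f x * snd v, partial1 g x * fst v + partial2 g x * snd v))" for x
  have L_lin: "bounded_linear (L x)" for x
    unfolding L_def
    by (intro bounded_linear_Pair bounded_linear_add bounded_linear_const_mult bounded_linear_fst bounded_linear_snd)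
  define F where "F = (\<lambda>q. (f q, g q))"
  define d where "d = partial1 f p * partial2 g p - partial2 f p * partial1 g p"
  \<comment> \<open>Cramer's inverse of the Jacobian matrix at \<open>p\<close>\<close>
  define K where "K = (\<lambda>v::complex \<times> complex. (partial2 g p / d * fst v + (- partial2 f p / d) * snd v, (- partial1 g p / d) * fst v + partial1 f p / d * snd v))"
  have K_lin: "bounded_linear K"
    unfolding K_def
    by (intro bounded_linear_Pair bounded_linear_add bounded_linear_const_mult bounded_linear_fst bounded_linear_snd)
  have d0: "d \<noteq> 0" using det d_def by simp
  have KL: "K (L p v) = v" for v
  proof -
    have "partial2 g p / d * (partial1 f p * fst v + partial2 f p * snd v) + (- partial2 f p / d) * (partial1 g p * fst v + partial2 g p * snd v)
      = (partial1 f p * partial2 g p - partial2 f p * partial1 g p) / d * fst v" by (simp add: field_simps d0)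
    moreover have "(- partial1 g p / d) * (partial1 f p * fst v + partial2 f p * snd v) + partial1 f p / d * (partial1 g p * fst v + partial2 g p * snd v)
      = (partial1 f p * partial2 g p - partial2 f p * partial1 g p) / d * snd v" by (simp add: field_simps d0)
    ultimately show ?thesis using d0 unfolding K_def L_def d_def[symmetric] by (simp add: prod_eq_iff)
  qed
  note ap = bounded_linear_Blinfun_apply[OF L_lin] bounded_linear_Blinfun_apply[OF K_lin]
  have "(F has_derivative blinfun_apply (Blinfun (L x))) (at x)" if "x \<in> S" for x
    unfolding ap F_def unfolding L_def
    by (intro has_derivative_Pair has_derivative_partials[OF f S that] has_derivative_partials[OF g S that])
  moreover have "continuous_on S (\<lambda>x. Blinfun (L x))"
  proof (rule continuous_on_blinfun_componentwise)
    show "continuous_on S (\<lambda>x. blinfun_apply (Blinfun (L x)) i)" for i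
      unfolding ap unfolding L_def
      by (intro continuous_intros continuous_on_partial1 continuous_on_partial2 f g S)
  qed
  moreover have "Blinfun K o\<^sub>L Blinfun (L p) = id_blinfun"
    by (rule blinfun_eqI) (simp add: ap KL)
  ultimately obtain U V G G' where UV: "open U" "U \<subseteq> S" "p \<in> U" "open V" "F p \<in> V" "homeomorphism U V F G"
    and dG: "\<And>y. y \<in> V \<Longrightarrow> (G has_derivative (G' y)) (at y)"
    and G': "\<And>y. y \<in> V \<Longrightarrow> G' y = inv (blinfun_apply (Blinfun (L (G y))))"
    and bij: "\<And>y. y \<in> V \<Longrightarrow> bij (blinfun_apply (Blinfun (L (G y))))"
    using inverse_function_theorem[OF S, of F "\<lambda>x. Blinfun (L x)" p "Blinfun K"] p by metis
  \<comment> \<open>complex linearity of the inverse derivative, read off from its values on the two unit vectors\<close>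
  have G'_eq: "G' y v = (fst (G' y (1, 0)) * fst v + fst (G' y (0, 1)) * snd v, snd (G' y (1, 0)) * fst v + snd (G' y (0, 1)) * snd v)"
    (is "_ = ?r") if "y \<in> V" for y v
  proof -
    have b: "bij (L (G y))" and i: "G' y = inv (L (G y))" using bij[OF that] G'[OF that] ap by auto
    have "L (G y) (G' y (1, 0)) = (1, 0)" "L (G y) (G' y (0, 1)) = (0, 1)"
      unfolding i using b by (simp_all add: bij_is_surj surj_f_inv_f)
    then have e: "partial1 f (G y) * fst (G' y (1, 0)) + partial2 f (G y) * snd (G' y (1, 0)) = 1"
      "partial1 g (G y) * fst (G' y (1, 0)) + partial2 g (G y) * snd (G' y (1, 0)) = 0"
      "partial1 f (G y) * fst (G' y (0, 1)) + partial2 f (G y) * snd (G' y (0, 1)) = 0"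
      "partial1 g (G y) * fst (G' y (0, 1)) + partial2 g (G y) * snd (G' y (0, 1)) = 1"
      unfolding L_def by auto
    have "L (G y) ?r = ((partial1 f (G y) * fst (G' y (1, 0)) + partial2 f (G y) * snd (G' y (1, 0))) * fst v
        + (partial1 f (G y) * fst (G' y (0, 1)) + partial2 f (G y) * snd (G' y (0, 1))) * snd v,
       (partial1 g (G y) * fst (G' y (1, 0)) + partial2 g (G y) * snd (G' y (1, 0))) * fst v
        + (partial1 g (G y) * fst (G' y (0, 1)) + partial2 g (G y) * snd (G' y (0, 1))) * snd v)"
      unfolding L_def by (simp add: algebra_simps)
    then have "L (G y) ?r = v" unfolding e by simp
    then show ?thesis unfolding i by (metis b bij_is_inj inv_f_f i)
  qed
  have "holomorphic2_on (\<lambda>y. fst (G y)) V"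
  proof (rule holomorphic2_onI_has_derivative)
    fix y assume y: "y \<in> V"
    have "((\<lambda>y. fst (G y)) has_derivative (\<lambda>v. fst (G' y v))) (at y)"
      by (rule has_derivative_fst[OF dG[OF y]])
    moreover have "(\<lambda>v. fst (G' y v)) = (\<lambda>v. fst (G' y (1, 0)) * fst v + fst (G' y (0, 1)) * snd v)"
      by (subst G'_eq[OF y]) simp
    ultimately show "((\<lambda>y. fst (G y)) has_derivative (\<lambda>v. fst (G' y (1, 0)) * fst v + fst (G' y (0, 1)) * snd v)) (at y)"
      by simp
  qed
  moreover have "holomorphic2_on (\<lambda>y. snd (G y)) V"
  proof (rule holomorphic2_onI_has_derivative)
    fix y assume y: "y \<in> V"
    have "((\<lambda>y. snd (G y)) has_derivative (\<lambda>v. snd (G' y v))) (at y)"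
      by (rule has_derivative_snd[OF dG[OF y]])
    moreover have "(\<lambda>v. snd (G' y v)) = (\<lambda>v. snd (G' y (1, 0)) * fst v + snd (G' y (0, 1)) * snd v)"
      by (subst G'_eq[OF y]) simp
    ultimately show "((\<lambda>y. snd (G y)) has_derivative (\<lambda>v. snd (G' y (1, 0)) * fst v + snd (G' y (0, 1)) * snd v)) (at y)"
      by simp
  qed
  moreover have "(f q, g q) \<in> V \<and> (fst (G (f q, g q)), snd (G (f q, g q))) = q" if "q \<in> U" for q
    using UV(6) that unfolding homeomorphism_def F_def by auto
  ultimately show thesis using that UV by blast
qed

section \<open>Real functions with holomorphic extensions\<close>

definition of_real2 :: "real \<times> real \<Rightarrow> complex \<times> complex" where
  "of_real2 x = (of_real (fst x), of_real (snd x))"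

text \<open>
  Agreement at all real points of the domain, rather than near a chosen one, is stable under shrinking
  the domain and allows re-centring at any other real point in it.
\<close>
definition holomorphic_extension :: "(complex \<times> complex \<Rightarrow> complex) \<Rightarrow> (complex \<times> complex) set \<Rightarrow> (real \<times> real \<Rightarrow> real) \<Rightarrow> bool" where
  "holomorphic_extension f S u \<longleftrightarrow> open S \<and> holomorphic2_on f S \<and> (\<forall>x. of_real2 x \<in> S \<longrightarrow> f (of_real2 x) = of_real (u x))"

text \<open>
  This is real analyticity at a point in the form used below; the two lemmas on power series
  show that it is equivalent to a local expansion into a double power series.
\<close>
definition extends_holomorphically_at :: "(real \<times> real \<Rightarrow> real) \<Rightarrow> real \<times> real \<Rightarrow> bool" where
  "extends_holomorphically_at u p \<longleftrightarrow> (\<exists>f S. holomorphic_extension f S u \<and> of_real2 p \<in> S)"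

lemma bounded_linear_of_real2: "bounded_linear of_real2"
  unfolding of_real2_def [abs_def]
  by (intro bounded_linear_Pair bounded_linear_compose[OF bounded_linear_of_real] bounded_linear_fst bounded_linear_snd)

lemma dist_of_real2: "dist (of_real2 x) (of_real2 y) = dist x y"
  by (cases x; cases y) (simp add: of_real2_def dist_Pair_Pair dist_of_real)

text \<open>
  The partial derivatives of an extension are real at real points, since its imaginary part vanishes
  along the real plane. So a real Jacobian determinant equals the complex one of the extensions.
\<close>
lemma holomorphic_extension_derivative:
  assumes f: "holomorphic_extension f S u" and p: "of_real2 p \<in> S"
  obtains a b where "partial1 f (of_real2 p) = of_real a" "partial2 f (of_real2 p) = of_real b"
    "(u has_derivative (\<lambda>h. a * fst h + b * snd h)) (at p)"
proof -
  have S: "open S" and hol: "holomorphic2_on f S" and eq: "\<And>x. of_real2 x \<in> S \<Longrightarrow> f (of_real2 x) = of_real (u x)"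
    using f unfolding holomorphic_extension_def by auto
  define a b where "a = partial1 f (of_real2 p)" and "b = partial2 f (of_real2 p)"
  have "open (of_real2 -` S)"
    using open_vimage[OF S] bounded_linear_of_real2 linear_continuous_on by blast
  then obtain d where d: "d > 0" "ball p d \<subseteq> of_real2 -` S"
    using p open_contains_ball by (metis vimageI)
  have der: "((\<lambda>x. f (of_real2 x)) has_derivative (\<lambda>h. a * fst (of_real2 h) + b * snd (of_real2 h))) (at p)"
    using has_derivative_compose[OF bounded_linear_imp_has_derivative[OF bounded_linear_of_real2] has_derivative_partials[OF hol S p]]
    unfolding a_def b_def .
  then have "((\<lambda>x. of_real (u x)) has_derivative (\<lambda>h. a * fst (of_real2 h) + b * snd (of_real2 h))) (at p)"
  proof (rule has_derivative_transform_within_open[OF _ open_ball[of p d]])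
    fix x assume "x \<in> ball p d"
    then show "f (of_real2 x) = of_real (u x)" using d(2) eq[of x] by blast
  qed (use d in auto)
  then have der': "((\<lambda>x. of_real (u x)) has_derivative (\<lambda>h. a * of_real (fst h) + b * of_real (snd h))) (at p)"
    unfolding of_real2_def by simp
  have "((\<lambda>x. Im (of_real (u x))) has_derivative (\<lambda>h. Im (a * of_real (fst h) + b * of_real (snd h)))) (at p)"
    by (rule bounded_linear.has_derivative[OF bounded_linear_Im der'])
  then have "((\<lambda>x. 0) has_derivative (\<lambda>h. Im a * fst h + Im b * snd h)) (at p)"
    by simp
  then have z: "(\<lambda>h. Im a * fst h + Im b * snd h) = (\<lambda>h. 0)"
    using has_derivative_unique has_derivative_const by blast
  have "Im a = 0" "Im b = 0" using fun_cong[OF z, of "(1,0)"] fun_cong[OF z, of "(0,1)"] by auto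
  moreover have "((\<lambda>x. Re (of_real (u x))) has_derivative (\<lambda>h. Re (a * of_real (fst h) + b * of_real (snd h)))) (at p)"
    by (rule bounded_linear.has_derivative[OF bounded_linear_Re der'])
  then have "(u has_derivative (\<lambda>h. Re a * fst h + Re b * snd h)) (at p)"
    by simp
  ultimately show thesis using that[of "Re a" "Re b"] unfolding a_def b_def
    by (simp add: complex_eq_iff)
qed

text \<open>
  A convergent real family is absolutely convergent, so convergence at the single point $(\rho, \rho)$
  gives convergence on a complex polydisc.
\<close>
lemma power_series_extends_holomorphically:
  fixes c :: "nat \<Rightarrow> nat \<Rightarrow> real"
  assumes r: "r > 0"
    and u: "\<And>s t. \<bar>s\<bar> < r \<Longrightarrow> \<bar>t\<bar> < r \<Longrightarrow> ((\<lambda>(m, n). c m n * s ^ m * t ^ n) has_sum u (p + (s, t))) UNIV"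
  shows "extends_holomorphically_at u p"
proof -
  define \<rho> where "\<rho> = r / 2"
  have \<rho>: "0 < \<rho>" "\<rho> < r" using r by (auto simp: \<rho>_def)
  have "(\<lambda>(m, n). c m n * \<rho> ^ m * \<rho> ^ n) summable_on UNIV"
    using has_sum_imp_summable[OF u[of \<rho> \<rho>]] \<rho> by simp
  then have "(\<lambda>k. norm ((\<lambda>(m, n). c m n * \<rho> ^ m * \<rho> ^ n) k)) summable_on UNIV"
    using summable_on_iff_abs_summable_on_real by blast
  then have summ: "(\<lambda>(m, n). norm (complex_of_real (c m n)) * \<rho> ^ m * \<rho> ^ n) summable_on UNIV"
    using \<rho> by (simp add: case_prod_unfold abs_mult power_abs)
  define f where "f q = (\<Sum>\<^sub>\<infinity>(m, n). complex_of_real (c m n) * (fst q - of_real (fst p)) ^ m * (snd q - of_real (snd p)) ^ n)" for q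
  define S where "S = ball (complex_of_real (fst p)) \<rho> \<times> ball (complex_of_real (snd p)) \<rho>"
  have "holomorphic_extension f S u"
    unfolding holomorphic_extension_def
  proof (intro conjI allI impI)
    show "open S" unfolding S_def by (intro open_Times) auto
    show "holomorphic2_on f S" unfolding f_def [abs_def] S_def by (rule power_series_holomorphic2[OF summ])
    fix x assume "of_real2 x \<in> S"
    then have "\<bar>fst x - fst p\<bar> < r" "\<bar>snd x - snd p\<bar> < r"
      using \<rho> unfolding S_def of_real2_def by (auto simp: dist_norm abs_minus_commute simp flip: of_real_diff)
    from u[OF this] have "((\<lambda>(m, n). c m n * (fst x - fst p) ^ m * (snd x - snd p) ^ n) has_sum u x) UNIV"
      by (cases x; cases p) simp
    then have "((\<lambda>k. complex_of_real ((\<lambda>(m, n). c m n * (fst x - fst p) ^ m * (snd x - snd p) ^ n) k)) has_sum of_real (u x)) UNIV"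
      by (rule has_sum_of_real)
    then have "((\<lambda>(m, n). complex_of_real (c m n) * (fst (of_real2 x) - of_real (fst p)) ^ m * (snd (of_real2 x) - of_real (snd p)) ^ n) has_sum of_real (u x)) UNIV"
      by (simp add: case_prod_unfold of_real2_def)
    then show "f (of_real2 x) = of_real (u x)"
      unfolding f_def by (rule infsumI)
  qed
  moreover have "of_real2 p \<in> S" using \<rho> unfolding S_def of_real2_def by auto
  ultimately show ?thesis unfolding extends_holomorphically_at_def by blast
qed

text \<open>
  At real arguments the complex expansion has real values, so the real parts of its coefficients
  already give an expansion.
\<close>
lemma extends_holomorphically_power_series:
  assumes "extends_holomorphically_at u p"
  obtains r and c :: "nat \<Rightarrow> nat \<Rightarrow> real" where "r > 0"
    "\<And>s t. \<bar>s\<bar> < r \<Longrightarrow> \<bar>t\<bar> < r \<Longrightarrow> ((\<lambda>(m, n). c m n * s ^ m * t ^ n) has_sum u (p + (s, t))) UNIV"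
proof -
  obtain f S where f: "holomorphic_extension f S u" and p: "of_real2 p \<in> S"
    using assms unfolding extends_holomorphically_at_def by blast
  have S: "open S" and hol: "holomorphic2_on f S" and eq: "\<And>x. of_real2 x \<in> S \<Longrightarrow> f (of_real2 x) = of_real (u x)"
    using f unfolding holomorphic_extension_def by auto
  obtain r c where r: "r > 0" and c: "\<And>z w. norm z < r \<Longrightarrow> norm w < r \<Longrightarrow>
       ((\<lambda>(m, n). c m n * z ^ m * w ^ n) has_sum f (fst (of_real2 p) + z, snd (of_real2 p) + w)) UNIV"
    using holomorphic2_power_series[OF hol S p] by blast
  obtain d where d: "d > 0" "cball (fst (of_real2 p)) d \<times> cball (snd (of_real2 p)) d \<subseteq> S"
    using open_contains_polydisc[OF S p] by blast
  show thesis
  proof (rule that[of "min r d" "\<lambda>m n. Re (c m n)"])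
    fix s t :: real assume s: "\<bar>s\<bar> < min r d" and t: "\<bar>t\<bar> < min r d"
    have e: "(fst (of_real2 p) + of_real s, snd (of_real2 p) + of_real t) = of_real2 (p + (s, t))"
      by (simp add: of_real2_def)
    have "of_real2 (p + (s, t)) \<in> S" unfolding e[symmetric]
      by (rule subsetD[OF d(2)]) (use s t in \<open>auto simp: dist_norm\<close>)
    then have u: "f (of_real2 (p + (s, t))) = of_real (u (p + (s, t)))" by (rule eq)
    have "((\<lambda>k. Re ((\<lambda>(m, n). c m n * of_real s ^ m * of_real t ^ n) k)) has_sum Re (of_real (u (p + (s, t))))) UNIV"
      using has_sum_Re[OF c[of "of_real s" "of_real t"]] s t unfolding e u by simp
    then show "((\<lambda>(m, n). Re (c m n) * s ^ m * t ^ n) has_sum u (p + (s, t))) UNIV"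
      by (simp add: case_prod_unfold flip: of_real_power)
  qed (use r d in auto)
qed

lemma extends_holomorphically_has_derivative:
  assumes "extends_holomorphically_at u p"
  obtains a b where "(u has_derivative (\<lambda>h. a * fst h + b * snd h)) (at p)"
  using assms holomorphic_extension_derivative unfolding extends_holomorphically_at_def by metis

text \<open>
  Near \<open>p\<close> the map \<open>R\<close> is a local inverse of \<open>(v1, v2)\<close> composed with \<open>(u1, u2)\<close>. Continuity of
  \<open>R\<close> is what places its values in the neighbourhood on which that inverse is the correct branch.
\<close>
lemma analytic_implicit_pair:
  fixes R :: "real \<times> real \<Rightarrow> real \<times> real"
  assumes u: "extends_holomorphically_at u1 p" "extends_holomorphically_at u2 p"
    and v: "extends_holomorphically_at v1 (R p)" "extends_holomorphically_at v2 (R p)"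
    and dv1: "(v1 has_derivative (\<lambda>h. a1 * fst h + b1 * snd h)) (at (R p))"
    and dv2: "(v2 has_derivative (\<lambda>h. a2 * fst h + b2 * snd h)) (at (R p))"
    and det: "a1 * b2 - b1 * a2 \<noteq> 0"
    and cont: "isCont R p"
    and eq: "\<forall>\<^sub>F x in nhds p. v1 (R x) = u1 x \<and> v2 (R x) = u2 x"
  shows "extends_holomorphically_at (\<lambda>x. fst (R x)) p" "extends_holomorphically_at (\<lambda>x. snd (R x)) p"
proof -
  obtain f1 S1 f2 S2 where f: "holomorphic_extension f1 S1 u1" "of_real2 p \<in> S1"
      "holomorphic_extension f2 S2 u2" "of_real2 p \<in> S2"
    using u unfolding extends_holomorphically_at_def by blast
  obtain g1 T1 g2 T2 where g: "holomorphic_extension g1 T1 v1" "of_real2 (R p) \<in> T1"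
      "holomorphic_extension g2 T2 v2" "of_real2 (R p) \<in> T2"
    using v unfolding extends_holomorphically_at_def by blast
  have f': "open S1" "open S2" "holomorphic2_on f1 S1" "holomorphic2_on f2 S2"
     "\<And>x. of_real2 x \<in> S1 \<Longrightarrow> f1 (of_real2 x) = of_real (u1 x)"
     "\<And>x. of_real2 x \<in> S2 \<Longrightarrow> f2 (of_real2 x) = of_real (u2 x)"
    using f unfolding holomorphic_extension_def by auto
  have g': "open T1" "open T2" "holomorphic2_on g1 T1" "holomorphic2_on g2 T2"
     "\<And>x. of_real2 x \<in> T1 \<Longrightarrow> g1 (of_real2 x) = of_real (v1 x)"
     "\<And>x. of_real2 x \<in> T2 \<Longrightarrow> g2 (of_real2 x) = of_real (v2 x)"
    using g unfolding holomorphic_extension_def by auto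
  have unique: "a = a' \<and> b = b'" if
    "(w has_derivative (\<lambda>h. a * fst h + b * snd h)) (at x)" "(w has_derivative (\<lambda>h. a' * fst h + b' * snd h)) (at x)"
    for w :: "real \<times> real \<Rightarrow> real" and a b a' b' x
  proof -
    have e: "(\<lambda>h. a * fst h + b * snd h) = (\<lambda>h. a' * fst h + b' * snd h)"
      by (rule has_derivative_unique[OF that])
    show ?thesis using fun_cong[OF e, of "(1, 0)"] fun_cong[OF e, of "(0, 1)"] by simp
  qed
  have "partial1 g1 (of_real2 (R p)) = of_real a1" "partial2 g1 (of_real2 (R p)) = of_real b1"
    using holomorphic_extension_derivative[OF g(1,2)] unique[OF dv1] by metis+
  moreover have "partial1 g2 (of_real2 (R p)) = of_real a2" "partial2 g2 (of_real2 (R p)) = of_real b2"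
    using holomorphic_extension_derivative[OF g(3,4)] unique[OF dv2] by metis+
  moreover have "complex_of_real (a1 * b2 - b1 * a2) \<noteq> 0" using det of_real_eq_0_iff by blast
  ultimately have det': "partial1 g1 (of_real2 (R p)) * partial2 g2 (of_real2 (R p)) - partial2 g1 (of_real2 (R p)) * partial1 g2 (of_real2 (R p)) \<noteq> 0"
    by simp
  have "holomorphic2_on g1 (T1 \<inter> T2)" "holomorphic2_on g2 (T1 \<inter> T2)" "open (T1 \<inter> T2)" "of_real2 (R p) \<in> T1 \<inter> T2"
    using g g' holomorphic2_on_subset by auto
  from holomorphic2_inverse_function[OF this det'] obtain U V h k where
    UV: "open U" "of_real2 (R p) \<in> U" "U \<subseteq> T1 \<inter> T2" "open V" "holomorphic2_on h V" "holomorphic2_on k V"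
    and hk: "\<And>q. q \<in> U \<Longrightarrow> (g1 q, g2 q) \<in> V \<and> (h (g1 q, g2 q), k (g1 q, g2 q)) = q" by metis
  have "isCont (\<lambda>x. of_real2 (R x)) p"
    using cont bounded_linear.isCont[OF bounded_linear_of_real2] by blast
  then have "\<forall>\<^sub>F x in nhds p. of_real2 (R x) \<in> U"
    using topological_tendstoD[of "\<lambda>x. of_real2 (R x)" _ "nhds p"] UV(1,2)
    unfolding isCont_def by (simp add: tendsto_nhds_iff)
  with eq have "\<forall>\<^sub>F x in nhds p. of_real2 (R x) \<in> U \<and> v1 (R x) = u1 x \<and> v2 (R x) = u2 x"
    by eventually_elim auto
  then obtain \<delta> where \<delta>: "\<delta> > 0"
    "\<And>x. dist x p < \<delta> \<Longrightarrow> of_real2 (R x) \<in> U \<and> v1 (R x) = u1 x \<and> v2 (R x) = u2 x"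
    unfolding eventually_nhds_metric by blast
  \<comment> \<open>on this neighbourhood every real point is sent by \<open>R\<close> into \<open>U\<close>, so the inverse branch returns it\<close>
  define W0 where "W0 = S1 \<inter> S2 \<inter> ball (of_real2 p) \<delta>"
  have W0: "open W0" "W0 \<subseteq> S1" "W0 \<subseteq> S2" "of_real2 p \<in> W0" using f f' \<delta> unfolding W0_def by auto
  define W where "W = W0 \<inter> (\<lambda>w. (f1 w, f2 w)) -` V"
  have cont: "continuous_on W0 (\<lambda>w. (f1 w, f2 w))"
    using f'(3,4) W0 unfolding holomorphic2_on_def by (metis continuous_on_Pair continuous_on_subset)
  have W: "open W" unfolding W_def
    using continuous_open_preimage[OF cont W0(1) UV(4)] .
  have holf: "holomorphic2_on f1 W" "holomorphic2_on f2 W"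
    using f'(3,4) W0 holomorphic2_on_subset unfolding W_def by blast+
  have key: "(f1 (of_real2 x), f2 (of_real2 x)) \<in> V \<and>
      (h (f1 (of_real2 x), f2 (of_real2 x)), k (f1 (of_real2 x), f2 (of_real2 x))) = of_real2 (R x)"
    if "of_real2 x \<in> W0" for x
  proof -
    have "dist x p < \<delta>" using that unfolding W0_def by (simp add: dist_of_real2 dist_commute)
    from \<delta>(2)[OF this] have Rx: "of_real2 (R x) \<in> U" "v1 (R x) = u1 x" "v2 (R x) = u2 x" by auto
    have "of_real2 x \<in> S1" "of_real2 x \<in> S2" "of_real2 (R x) \<in> T1" "of_real2 (R x) \<in> T2"
      using that W0(2,3) Rx(1) UV(3) by blast+
    then have "f1 (of_real2 x) = g1 (of_real2 (R x))" "f2 (of_real2 x) = g2 (of_real2 (R x))"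
      using f'(5,6)[of x] g'(5,6)[of "R x"] Rx(2,3) by simp_all
    then show ?thesis using hk[OF Rx(1)] by simp
  qed
  have sub: "\<And>q. q \<in> W \<Longrightarrow> (f1 q, f2 q) \<in> V" unfolding W_def by auto
  have pW: "of_real2 p \<in> W" using key W0(4) unfolding W_def by auto
  have "holomorphic_extension (\<lambda>w. h (f1 w, f2 w)) W (\<lambda>x. fst (R x))"
    unfolding holomorphic_extension_def
    using W holomorphic2_on_compose[OF holf UV(5) W UV(4) sub] key
    by (auto simp: W_def of_real2_def)
  moreover have "holomorphic_extension (\<lambda>w. k (f1 w, f2 w)) W (\<lambda>x. snd (R x))"
    unfolding holomorphic_extension_def
    using W holomorphic2_on_compose[OF holf UV(6) W UV(4) sub] key
    by (auto simp: W_def of_real2_def)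
  ultimately show "extends_holomorphically_at (\<lambda>x. fst (R x)) p" "extends_holomorphically_at (\<lambda>x. snd (R x)) p"
    using pW unfolding extends_holomorphically_at_def by blast+
qed

text \<open>
  The identity theorem along a real line. Near a boundary point of the set where \<open>u\<close> is locally
  constant, the extension restricted to the complexified line is a holomorphic function of one variable
  that agrees with \<open>k\<close> on a set accumulating there. So that set is closed as well as open.
\<close>
lemma extends_constant_on_line:
  assumes u: "\<And>t. extends_holomorphically_at u (p + t *\<^sub>R q)"
    and c: "\<And>t. t \<in> {a<..<b} \<Longrightarrow> u (p + t *\<^sub>R q) = k" and ab: "a < b"
  shows "u (p + t *\<^sub>R q) = k"
proof -
  define T where "T = interior {t. u (p + t *\<^sub>R q) = k}"
  have "closure T \<subseteq> T"
  proof
    fix s assume s: "s \<in> closure T"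
    obtain f S where f: "holomorphic_extension f S u" and pS: "of_real2 (p + s *\<^sub>R q) \<in> S"
      using u[of s] unfolding extends_holomorphically_at_def by blast
    have S: "open S" and hol: "holomorphic2_on f S" and eq: "\<And>x. of_real2 x \<in> S \<Longrightarrow> f (of_real2 x) = of_real (u x)"
      using f unfolding holomorphic_extension_def by auto
    define l where "l = (\<lambda>z::complex. (of_real (fst p) + z * of_real (fst q), of_real (snd p) + z * of_real (snd q)))"
    have l_real: "l (of_real t) = of_real2 (p + t *\<^sub>R q)" for t unfolding l_def of_real2_def by simp
    have contl: "continuous_on UNIV l" unfolding l_def by (intro continuous_intros)
    have "open (l -` S)" by (rule open_vimage[OF S contl])
    moreover have "of_real s \<in> l -` S" using pS l_real by simp
    ultimately obtain d where d: "d > 0" "ball (of_real s) d \<subseteq> l -` S"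
      using open_contains_ball by metis
    have holo: "(\<lambda>z. f (l z) - of_real k) holomorphic_on ball (of_real s) d"
      unfolding holomorphic_on_def
    proof
      fix z assume z: "z \<in> ball (complex_of_real s) d"
      have "(l has_derivative (\<lambda>h. (h * of_real (fst q), h * of_real (snd q)))) (at z)"
        unfolding l_def by (auto intro!: derivative_eq_intros has_derivative_Pair)
      from has_derivative_compose[OF this has_derivative_partials[OF hol S]] z d
      have "((\<lambda>z. f (l z)) has_derivative (\<lambda>h. partial1 f (l z) * (h * of_real (fst q)) + partial2 f (l z) * (h * of_real (snd q)))) (at z)"
        by auto
      then have "((\<lambda>z. f (l z)) has_field_derivative partial1 f (l z) * of_real (fst q) + partial2 f (l z) * of_real (snd q)) (at z)"
        unfolding has_field_derivative_def by (rule has_derivative_eq_rhs) (auto simp: algebra_simps)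
      then have "((\<lambda>z. f (l z) - of_real k) has_field_derivative partial1 f (l z) * of_real (fst q) + partial2 f (l z) * of_real (snd q) - 0) (at z)"
        by (intro DERIV_diff DERIV_const)
      then show "(\<lambda>z. f (l z) - of_real k) field_differentiable at z within ball (complex_of_real s) d"
        using field_differentiable_def field_differentiable_at_within by blast
    qed
    define Z where "Z = complex_of_real ` (T \<inter> ball s d)"
    have Zd: "Z \<subseteq> ball (of_real s) d" unfolding Z_def by (auto simp: dist_of_real)
    have fl: "f (l (of_real t)) = of_real (u (p + t *\<^sub>R q))" if "t \<in> ball s d" for t
    proof -
      have "complex_of_real t \<in> ball (of_real s) d" using that by (simp add: dist_of_real)
      then have "of_real2 (p + t *\<^sub>R q) \<in> S" unfolding l_real[symmetric] using d(2) by blast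
      then show ?thesis using eq l_real by simp
    qed
    have "of_real s islimpt Z"
      unfolding islimpt_approachable
    proof (intro allI impI)
      fix e :: real assume "e > 0"
      define e' where "e' = min e d"
      have "e' > 0" using \<open>e > 0\<close> d e'_def by auto
      then obtain t where t: "t \<in> T" "dist t s < e'" using s closure_approachable by blast
      have "open (T \<inter> ball s e')" unfolding T_def by auto
      moreover have "t \<in> T \<inter> ball s e'" using t by (auto simp: dist_commute)
      ultimately have "infinite (T \<inter> ball s e')" by (metis empty_iff finite_imp_not_open)
      then obtain t' where t': "t' \<in> T \<inter> ball s e'" "t' \<noteq> s"
        by (metis finite.emptyI finite.insertI finite_subset insertI1 subsetI singletonD)
      then show "\<exists>x'\<in>Z. x' \<noteq> complex_of_real s \<and> dist x' (complex_of_real s) < e"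
        unfolding Z_def e'_def by (intro bexI[of _ "of_real t'"]) (auto simp: dist_of_real dist_commute)
    qed
    have "f (l (of_real t)) - of_real k = 0" if "t \<in> ball s d" for t
    proof (rule analytic_continuation[OF holo _ _ Zd _ \<open>of_real s islimpt Z\<close>])
      fix z assume "z \<in> Z"
      then obtain t where t: "z = of_real t" "t \<in> T" "t \<in> ball s d" unfolding Z_def by auto
      have "u (p + t *\<^sub>R q) = k" using t(2) interior_subset unfolding T_def by blast
      then show "f (l z) - of_real k = 0" using fl[OF t(3)] t(1) by simp
    qed (use d that in \<open>auto simp: dist_of_real\<close>)
    then have "ball s d \<subseteq> {t. u (p + t *\<^sub>R q) = k}" using fl by fastforce
    then show "s \<in> T" unfolding T_def using d(1) interior_maximal[OF _ open_ball] centre_in_ball by blast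
  qed
  then have "closed T" by (simp add: closure_subset_eq)
  moreover have "open T" unfolding T_def by simp
  moreover have "{a<..<b} \<subseteq> T" unfolding T_def by (rule interior_maximal) (use c in auto)
  then have "T \<noteq> {}" using ab by fastforce
  ultimately have "T = UNIV" using clopen by blast
  then show ?thesis using interior_subset unfolding T_def by blast
qed

lemma extends_holomorphically_shift:
  assumes "extends_holomorphically_at u (p - a)"
  shows "extends_holomorphically_at (\<lambda>q. u (q - a)) p"
proof -
  obtain r c where r: "r > 0" "\<And>s t. \<bar>s\<bar> < r \<Longrightarrow> \<bar>t\<bar> < r \<Longrightarrow> ((\<lambda>(m, n). c m n * s ^ m * t ^ n) has_sum u (p - a + (s, t))) UNIV"
    by (rule extends_holomorphically_power_series[OF assms]) (rule that)
  show ?thesis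
    by (rule power_series_extends_holomorphically[OF r(1), of c]) (use r(2) in \<open>simp add: algebra_simps\<close>)
qed

section \<open>Coordinates in a normed plane\<close>

locale plane_basis =
  fixes b1 b2 :: "'a::real_normed_vector"
  assumes basis_distinct: "b1 \<noteq> b2"
    and basis_independent: "independent {b1, b2}"
    and basis_span: "span {b1, b2} = UNIV"
begin

definition coords :: "'a \<Rightarrow> real \<times> real" where
  "coords x = (representation {b1, b2} x b1, representation {b1, b2} x b2)"

definition point :: "real \<times> real \<Rightarrow> 'a" where
  "point q = fst q *\<^sub>R b1 + snd q *\<^sub>R b2"

lemma point_coords [simp]: "point (coords x) = x"
proof -
  have "(\<Sum>b\<in>{b1, b2}. representation {b1, b2} x b *\<^sub>R b) = x"
    by (rule real_vector.sum_representation_eq[OF basis_independent]) (auto simp: basis_span)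
  then show ?thesis using basis_distinct by (simp add: point_def coords_def)
qed

lemma linear_coords: "linear coords"
  by (rule linearI)
     (simp_all add: coords_def real_vector.representation_add real_vector.representation_scale basis_independent basis_span)

lemma coords_point [simp]: "coords (point q) = q"
proof -
  have "coords b1 = (1, 0)" "coords b2 = (0, 1)"
    using basis_distinct by (auto simp: coords_def real_vector.representation_basis[OF basis_independent])
  then show ?thesis
    unfolding point_def by (simp add: linear_add[OF linear_coords] linear_scale[OF linear_coords])
qed

lemma bounded_linear_point: "bounded_linear point"
  unfolding point_def [abs_def]
  by (intro bounded_linear_add bounded_linear_compose[OF bounded_linear_scaleR_left] bounded_linear_fst bounded_linear_snd)

text \<open>
  The plane is an abstract normed space, so equivalence with the norm of the coordinate space has to be
  derived: the norm attains a positive minimum on the Euclidean unit circle.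
\<close>
lemma bounded_linear_coords: "bounded_linear coords"
proof -
  have "continuous_on (sphere 0 1) (\<lambda>q. norm (point q))"
    by (intro continuous_on_norm bounded_linear.continuous_on[OF bounded_linear_point] continuous_on_id)
  moreover have "(1, 0) \<in> sphere (0 :: real \<times> real) 1" by simp
  ultimately obtain q0 where q0: "q0 \<in> sphere 0 1" "\<And>q. q \<in> sphere 0 1 \<Longrightarrow> norm (point q0) \<le> norm (point q)"
    using continuous_attains_inf[OF compact_sphere, of "0 :: real \<times> real" 1] by blast
  define m where "m = norm (point q0)"
  have "coords (point q0) \<noteq> 0" using q0(1) by auto
  then have "point q0 \<noteq> 0" using linear_0[OF linear_coords] by metis
  then have m: "m > 0" unfolding m_def by simp
  have "norm (coords x) \<le> norm x * (1 / m)" for x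
  proof (cases "coords x = 0")
    case False
    define q where "q = (1 / norm (coords x)) *\<^sub>R coords x"
    have "point q = (1 / norm (coords x)) *\<^sub>R x"
      unfolding q_def using linear_scale[OF bounded_linear.linear[OF bounded_linear_point]] by simp
    moreover have "q \<in> sphere 0 1" unfolding q_def using False by simp
    ultimately have "m \<le> norm x / norm (coords x)" using q0(2)[of q] unfolding m_def by simp
    then show ?thesis using False m by (simp add: field_simps)
  qed (use m in simp)
  with linear_add[OF linear_coords] linear_scale[OF linear_coords] show ?thesis
    by (rule bounded_linear_intro)
qed

lemmas linear_point = bounded_linear.linear[OF bounded_linear_point]

lemma continuous_on_coords: "continuous_on S coords"
  by (rule linear_continuous_on[OF bounded_linear_coords])

lemma continuous_on_point: "continuous_on S point"
  by (rule linear_continuous_on[OF bounded_linear_point])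

text \<open>
  The determinant of two vectors in the chosen coordinates. As a function of \<open>x\<close>, \<open>area x z\<close>
  vanishes exactly on the line through \<open>0\<close> and \<open>z\<close>, and its sign tells the two sides apart.
\<close>
definition area :: "'a \<Rightarrow> 'a \<Rightarrow> real" where
  "area x y = fst (coords x) * snd (coords y) - snd (coords x) * fst (coords y)"

lemma area_simps [simp]:
  "area (x + y) z = area x z + area y z" "area z (x + y) = area z x + area z y"
  "area (x - y) z = area x z - area y z" "area z (x - y) = area z x - area z y"
  "area (- x) z = - area x z" "area z (- x) = - area z x"
  "area (c *\<^sub>R x) z = c * area x z" "area z (c *\<^sub>R x) = c * area z x"
  "area x x = 0" "area 0 x = 0" "area x 0 = 0"
  by (simp_all add: area_def linear_add[OF linear_coords] linear_scale[OF linear_coords]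
        linear_diff[OF linear_coords] linear_neg[OF linear_coords] linear_0[OF linear_coords] algebra_simps)

lemma area_swap: "area x y = - area y x"
  by (simp add: area_def)

lemma continuous_on_area: "continuous_on S f \<Longrightarrow> continuous_on S g \<Longrightarrow> continuous_on S (\<lambda>x. area (f x) (g x))"
  unfolding area_def by (intro continuous_intros continuous_on_compose2[OF continuous_on_coords]) auto

text \<open>
  Cramer's rule in a form free of division.
\<close>
lemma area_expansion: "area x z *\<^sub>R y = area y z *\<^sub>R x + area x y *\<^sub>R z"
proof -
  have "coords (area x z *\<^sub>R y) = coords (area y z *\<^sub>R x + area x y *\<^sub>R z)"
    unfolding linear_add[OF linear_coords] linear_scale[OF linear_coords]
    by (simp add: prod_eq_iff area_def algebra_simps)
  then show ?thesis by (metis point_coords)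
qed

lemma expand_in_basis:
  assumes "area x z \<noteq> 0"
  obtains \<alpha> \<beta> where "y = \<alpha> *\<^sub>R x + \<beta> *\<^sub>R z" "\<alpha> = area y z / area x z"
proof
  have "y = (1 / area x z) *\<^sub>R (area x z *\<^sub>R y)" using assms by simp
  also have "\<dots> = (area y z / area x z) *\<^sub>R x + (area x y / area x z) *\<^sub>R z"
    unfolding area_expansion[of x z y] by (simp add: scaleR_add_right)
  finally show "y = (area y z / area x z) *\<^sub>R x + (area x y / area x z) *\<^sub>R z" .
qed auto

lemma area_eq_0_iff_span:
  assumes "z \<noteq> 0" shows "area x z = 0 \<longleftrightarrow> x \<in> span {z}"
proof
  assume a: "area x z = 0"
  have "\<exists>y. area y z \<noteq> 0"
  proof (rule ccontr)
    assume "\<not> ?thesis"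
    then have "area (point (1, 0)) z = 0" "area (point (0, 1)) z = 0" by auto
    then have "coords z = 0" by (simp add: area_def prod_eq_iff)
    then have "point (coords z) = 0" by (simp only: linear_0[OF linear_point])
    then show False using assms by simp
  qed
  then obtain y where "area y z \<noteq> 0" by blast
  from expand_in_basis[OF this, of x] a obtain \<beta> where "x = \<beta> *\<^sub>R z" by (metis add_0 div_0 scaleR_zero_left)
  then show "x \<in> span {z}" by (simp add: span_base span_scale)
next
  assume "x \<in> span {z}"
  then show "area x z = 0" unfolding span_singleton by auto
qed

text \<open>
  The bijection between pairs of exponents and the extensional functions on the basis by which
  \<^const>\<open>real_analytic_wrt\<close> indexes its power series.
\<close>
definition multi_index :: "nat \<times> nat \<Rightarrow> 'a \<Rightarrow> nat" where
  "multi_index k = (\<lambda>b\<in>{b1, b2}. if b = b1 then fst k else snd k)"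

lemma bij_multi_index: "bij_betw multi_index UNIV ({b1, b2} \<rightarrow>\<^sub>E UNIV)"
proof (rule bij_betw_byWitness[where f' = "\<lambda>\<alpha>. (\<alpha> b1, \<alpha> b2)"])
  show "\<forall>k\<in>UNIV. (multi_index k b1, multi_index k b2) = k"
    using basis_distinct by (simp add: multi_index_def)
  show "\<forall>\<alpha>\<in>{b1, b2} \<rightarrow>\<^sub>E UNIV. multi_index (\<alpha> b1, \<alpha> b2) = \<alpha>"
  proof
    fix \<alpha> :: "'a \<Rightarrow> nat" assume \<alpha>: "\<alpha> \<in> {b1, b2} \<rightarrow>\<^sub>E UNIV"
    show "multi_index (\<alpha> b1, \<alpha> b2) = \<alpha>"
    proof
      fix b show "multi_index (\<alpha> b1, \<alpha> b2) b = \<alpha> b"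
        using PiE_arb[OF \<alpha>, of b] by (cases "b \<in> {b1, b2}") (auto simp: multi_index_def)
    qed
  qed
  show "range multi_index \<subseteq> {b1, b2} \<rightarrow>\<^sub>E UNIV"
    unfolding multi_index_def [abs_def] by (intro image_subsetI restrict_PiE) auto
qed auto

lemma has_sum_multi_index:
  "((\<lambda>\<alpha>. (\<Prod>b\<in>{b1, b2}. representation {b1, b2} v b ^ \<alpha> b) *\<^sub>R c \<alpha>) has_sum y) ({b1, b2} \<rightarrow>\<^sub>E UNIV)
   \<longleftrightarrow> ((\<lambda>(m, n). (fst (coords v) ^ m * snd (coords v) ^ n) *\<^sub>R c (multi_index (m, n))) has_sum y) UNIV"
proof -
  have "((\<lambda>\<alpha>. (\<Prod>b\<in>{b1, b2}. representation {b1, b2} v b ^ \<alpha> b) *\<^sub>R c \<alpha>) has_sum y) ({b1, b2} \<rightarrow>\<^sub>E UNIV)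
   \<longleftrightarrow> ((\<lambda>k. (\<Prod>b\<in>{b1, b2}. representation {b1, b2} v b ^ multi_index k b) *\<^sub>R c (multi_index k)) has_sum y) UNIV"
    by (rule has_sum_reindex_bij_betw[OF bij_multi_index, symmetric])
  also have "(\<lambda>k. (\<Prod>b\<in>{b1, b2}. representation {b1, b2} v b ^ multi_index k b) *\<^sub>R c (multi_index k))
     = (\<lambda>(m, n). (fst (coords v) ^ m * snd (coords v) ^ n) *\<^sub>R c (multi_index (m, n)))"
    using basis_distinct by (auto simp: multi_index_def coords_def fun_eq_iff)
  finally show ?thesis .
qed

lemma real_analytic_extends:
  fixes f :: "'a \<Rightarrow> real"
  assumes f: "real_analytic_wrt {b1, b2} S f" and x: "x \<in> S"
  shows "extends_holomorphically_at (\<lambda>q. f (point q)) (coords x)"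
proof -
  obtain r c where r: "r > 0" and c: "\<And>y. y \<in> ball x r \<Longrightarrow>
      ((\<lambda>\<alpha>. (\<Prod>b\<in>{b1, b2}. representation {b1, b2} (y - x) b ^ \<alpha> b) *\<^sub>R c \<alpha>) has_sum f y) ({b1, b2} \<rightarrow>\<^sub>E UNIV)"
    using f x unfolding real_analytic_wrt_def by blast
  define M where "M = norm b1 + norm b2 + 1"
  have M: "M > 0" unfolding M_def by (simp add: add_nonneg_pos)
  show ?thesis
  proof (rule power_series_extends_holomorphically[where r = "r / M" and c = "\<lambda>m n. c (multi_index (m, n))"])
    show "r / M > 0" using r M by simp
    fix s t :: real assume s: "\<bar>s\<bar> < r / M" and t: "\<bar>t\<bar> < r / M"
    have "norm (point (s, t)) \<le> \<bar>s\<bar> * norm b1 + \<bar>t\<bar> * norm b2"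
      unfolding point_def using norm_triangle_ineq[of "s *\<^sub>R b1" "t *\<^sub>R b2"] by simp
    also have "\<dots> \<le> r / M * norm b1 + r / M * norm b2"
      using s t by (intro add_mono mult_right_mono) auto
    also have "\<dots> = r / M * (norm b1 + norm b2)" by (simp add: algebra_simps)
    also have "\<dots> < r / M * M" using r M by (intro mult_strict_left_mono) (auto simp: M_def)
    also have "\<dots> = r" using M by simp
    finally have v: "norm (point (s, t)) < r" .
    then have "x + point (s, t) \<in> ball x r" by (simp add: dist_norm)
    from c[OF this] have "((\<lambda>(m, n). (s ^ m * t ^ n) *\<^sub>R c (multi_index (m, n))) has_sum f (x + point (s, t))) UNIV"
      unfolding has_sum_multi_index by simp
    moreover have "point (coords x + (s, t)) = x + point (s, t)" by (simp add: linear_add[OF linear_point])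
    ultimately show "((\<lambda>(m, n). c (multi_index (m, n)) * s ^ m * t ^ n) has_sum f (point (coords x + (s, t)))) UNIV"
      by (simp add: mult_ac)
  qed
qed

text \<open>
  The expansions of the two coordinates are combined into one series with vector coefficients. The
  radius is divided by a bound for the coordinate map, since balls refer to the norm of the plane.
\<close>
lemma real_analytic_wrtI_extends:
  fixes f :: "'a \<Rightarrow> 'a"
  assumes "\<And>x. x \<in> S \<Longrightarrow> extends_holomorphically_at (\<lambda>q. fst (coords (f (point q)))) (coords x)"
    and "\<And>x. x \<in> S \<Longrightarrow> extends_holomorphically_at (\<lambda>q. snd (coords (f (point q)))) (coords x)"
  shows "real_analytic_wrt {b1, b2} S f"
  unfolding real_analytic_wrt_def
proof
  fix x assume x: "x \<in> S"
  obtain r1 c1 where r1: "r1 > 0" and c1: "\<And>s t. \<bar>s\<bar> < r1 \<Longrightarrow> \<bar>t\<bar> < r1 \<Longrightarrow>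
      ((\<lambda>(m, n). c1 m n * s ^ m * t ^ n) has_sum fst (coords (f (point (coords x + (s, t)))))) UNIV"
    by (rule extends_holomorphically_power_series[OF assms(1)[OF x]]) (rule that)
  obtain r2 c2 where r2: "r2 > 0" and c2: "\<And>s t. \<bar>s\<bar> < r2 \<Longrightarrow> \<bar>t\<bar> < r2 \<Longrightarrow>
      ((\<lambda>(m, n). c2 m n * s ^ m * t ^ n) has_sum snd (coords (f (point (coords x + (s, t)))))) UNIV"
    by (rule extends_holomorphically_power_series[OF assms(2)[OF x]]) (rule that)
  obtain K where K: "K > 0" "\<And>v. norm (coords v) \<le> norm v * K"
    using bounded_linear.pos_bounded[OF bounded_linear_coords] by blast
  define r where "r = min r1 r2"
  define c where "c \<alpha> = point (c1 (\<alpha> b1) (\<alpha> b2), c2 (\<alpha> b1) (\<alpha> b2))" for \<alpha> :: "'a \<Rightarrow> nat"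
  show "\<exists>r>0. \<exists>c. \<forall>y\<in>ball x r. ((\<lambda>\<alpha>. (\<Prod>b\<in>{b1, b2}. representation {b1, b2} (y - x) b ^ \<alpha> b) *\<^sub>R c \<alpha>) has_sum f y) ({b1, b2} \<rightarrow>\<^sub>E UNIV)"
  proof (intro exI[of _ "r / K"] exI[of _ c] conjI ballI)
    show "0 < r / K" using r1 r2 K by (simp add: r_def)
    fix y assume y: "y \<in> ball x (r / K)"
    define s t where "s = fst (coords (y - x))" and "t = snd (coords (y - x))"
    have st: "coords (y - x) = (s, t)" by (simp add: s_def t_def)
    have "norm (coords (y - x)) < r"
      using K(2)[of "y - x"] y K(1) by (simp add: dist_norm norm_minus_commute pos_less_divide_eq)
    then have s: "\<bar>s\<bar> < r" and t: "\<bar>t\<bar> < r"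
      using norm_fst_le[of s t] norm_snd_le[of t s] unfolding st by auto
    have "coords x + (s, t) = coords y" unfolding st[symmetric] by (simp add: linear_diff[OF linear_coords])
    then have y_eq: "point (coords x + (s, t)) = y" by simp
    have h1: "((\<lambda>(m, n). c1 m n * s ^ m * t ^ n) has_sum fst (coords (f y))) UNIV"
      using c1[of s t] s t unfolding y_eq by (simp add: r_def)
    have h2: "((\<lambda>(m, n). c2 m n * s ^ m * t ^ n) has_sum snd (coords (f y))) UNIV"
      using c2[of s t] s t unfolding y_eq by (simp add: r_def)
    have "((\<lambda>k. (case k of (m, n) \<Rightarrow> c1 m n * s ^ m * t ^ n) *\<^sub>R b1 + (case k of (m, n) \<Rightarrow> c2 m n * s ^ m * t ^ n) *\<^sub>R b2)
       has_sum (fst (coords (f y)) *\<^sub>R b1 + snd (coords (f y)) *\<^sub>R b2)) UNIV"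
      by (intro has_sum_add has_sum_bounded_linear[OF bounded_linear_scaleR_left] h1 h2)
    moreover have "fst (coords (f y)) *\<^sub>R b1 + snd (coords (f y)) *\<^sub>R b2 = f y"
      using point_coords[of "f y"] unfolding point_def .
    moreover have "(\<lambda>k. (case k of (m, n) \<Rightarrow> c1 m n * s ^ m * t ^ n) *\<^sub>R b1 + (case k of (m, n) \<Rightarrow> c2 m n * s ^ m * t ^ n) *\<^sub>R b2)
       = (\<lambda>(m, n). (fst (coords (y - x)) ^ m * snd (coords (y - x)) ^ n) *\<^sub>R c (multi_index (m, n)))"
      using basis_distinct unfolding st c_def point_def multi_index_def
      by (auto simp: fun_eq_iff scaleR_add_right mult_ac)
    ultimately show "((\<lambda>\<alpha>. (\<Prod>b\<in>{b1, b2}. representation {b1, b2} (y - x) b ^ \<alpha> b) *\<^sub>R c \<alpha>) has_sum f y) ({b1, b2} \<rightarrow>\<^sub>E UNIV)"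
      unfolding has_sum_multi_index by simp
  qed
qed

end

section \<open>Intersections of two spheres in a strictly convex plane\<close>

locale strictly_convex_plane = plane_basis b1 b2
  for b1 b2 :: "'a::real_normed_vector" +
  assumes strict_triangle: "area u v \<noteq> 0 \<Longrightarrow> norm (u + v) < norm u + norm v"
begin

lemma strict_triangle_diff: "area u v \<noteq> 0 \<Longrightarrow> norm (u - v) < norm u + norm v"
  using strict_triangle[of u "- v"] by simp

text \<open>
  Here \<open>y\<close> lies on the other side of the line through \<open>0\<close> and \<open>x\<close> than \<open>z\<close>, and not farther from
  the base line than \<open>x\<close>. Then the segment from \<open>z\<close> to \<open>y\<close> meets the segment from \<open>0\<close> to \<open>x\<close> in a point
  \<open>w\<close>. In the quadrilateral formed by the four points the sum of the diagonals exceeds the sum of two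
  opposite sides, whereas the equal norms make these sums equal.
\<close>
lemma no_crossing_triangles:
  assumes xz: "area x z \<noteq> 0" and \<alpha>: "0 < \<alpha>" "\<alpha> \<le> 1" and \<beta>: "\<beta> < 0"
    and y: "y = \<alpha> *\<^sub>R x + \<beta> *\<^sub>R z"
    and norms: "norm y = norm x" "norm (y - z) = norm (x - z)"
  shows False
proof -
  define B where "B = - \<beta>"
  define c where "c = \<alpha> / (1 + B)"
  define w where "w = c *\<^sub>R x"
  have B: "B > 0" using \<beta> B_def by simp
  have c: "0 < c" "c \<le> 1" unfolding c_def using B \<alpha> by auto
  have \<alpha>x: "\<alpha> *\<^sub>R x = (1 + B) *\<^sub>R w" unfolding w_def c_def using B by simp
  have yw: "y - w = B *\<^sub>R (w - z)" and yz: "y - z = (1 + B) *\<^sub>R (w - z)"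
    unfolding y \<alpha>x B_def by (simp_all add: algebra_simps)
  have nyz: "norm (y - z) = (1 + B) * norm (w - z)" unfolding yz using B by simp
  have "area w (y - w) \<noteq> 0" unfolding yw unfolding w_def using B c xz by simp
  from strict_triangle[OF this] have "norm y < norm w + norm (y - w)" by simp
  then have "norm y < norm w + B * norm (w - z)"
    unfolding yw using B by simp
  then have 1: "norm y < c * norm x + B * norm (w - z)" unfolding w_def using c by simp
  have "x - z = (1 - c) *\<^sub>R x + (w - z)" unfolding w_def by (simp add: algebra_simps)
  then have "norm (x - z) \<le> norm ((1 - c) *\<^sub>R x) + norm (w - z)" by (metis norm_triangle_ineq)
  then have "norm (x - z) \<le> (1 - c) * norm x + norm (w - z)" using c by simp
  with 1 nyz norms show False by (simp add: algebra_simps)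
qed

text \<open>
  Assume that \<open>y\<close> is not farther from the base line than \<open>x\<close>. It lies either in the triangle with
  vertices \<open>0\<close>, \<open>z\<close>, \<open>x\<close>, where convexity bounds the sum of its two distances by an average of
  $\|x\| + \|x - z\|$ and the smaller number $\|z\|$, or beyond one of the two sides, which
  \<open>no_crossing_triangles\<close> excludes (for the second side after translating by \<open>- z\<close>, which
  exchanges the centres).
\<close>
lemma same_side_unique_ordered:
  assumes xz: "area x z \<noteq> 0" and \<alpha>: "0 < \<alpha>" "\<alpha> \<le> 1"
    and y: "y = \<alpha> *\<^sub>R x + \<beta> *\<^sub>R z"
    and norms: "norm y = norm x" "norm (y - z) = norm (x - z)"
  shows "y = x"
proof -
  have \<beta>: "\<beta> \<ge> 0" using no_crossing_triangles[OF xz \<alpha> _ y norms] by (meson not_le)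
  have "\<not> 1 - \<alpha> - \<beta> < 0"
  proof
    assume neg: "1 - \<alpha> - \<beta> < 0"
    have e: "y - z = \<alpha> *\<^sub>R (x - z) + (1 - \<alpha> - \<beta>) *\<^sub>R (- z)" unfolding y by (simp add: algebra_simps)
    show False by (rule no_crossing_triangles[OF _ \<alpha> neg e]) (use xz norms in auto)
  qed
  then have \<gamma>: "1 - \<alpha> - \<beta> \<ge> 0" by simp
  have "norm y \<le> norm (\<alpha> *\<^sub>R x) + norm (\<beta> *\<^sub>R z)" unfolding y by (rule norm_triangle_ineq)
  then have 1: "norm x \<le> \<alpha> * norm x + \<beta> * norm z" using \<alpha> \<beta> norms by simp
  have "y - z = \<alpha> *\<^sub>R (x - z) - (1 - \<alpha> - \<beta>) *\<^sub>R z" unfolding y by (simp add: algebra_simps)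
  then have "norm (y - z) \<le> norm (\<alpha> *\<^sub>R (x - z)) + norm ((1 - \<alpha> - \<beta>) *\<^sub>R z)"
    by (metis norm_triangle_ineq4)
  then have 2: "norm (x - z) \<le> \<alpha> * norm (x - z) + (1 - \<alpha> - \<beta>) * norm z" using \<alpha> \<gamma> norms by simp
  have 3: "(1 - \<alpha>) * (norm x + norm (x - z)) \<le> (1 - \<alpha>) * norm z"
    using 1 2 by (simp add: algebra_simps)
  have 4: "norm z < norm x + norm (x - z)"
    using strict_triangle_diff[of x "x - z"] xz by simp
  have "\<alpha> = 1"
  proof (rule ccontr)
    assume "\<alpha> \<noteq> 1"
    then have "norm x + norm (x - z) \<le> norm z" using 3 \<alpha> by (simp add: mult_le_cancel_left)
    with 4 show False by simp
  qed
  then show ?thesis using \<beta> \<gamma> y by simp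
qed

lemma same_side_unique:
  assumes side: "area x z * area y z > 0"
    and norms: "norm y = norm x" "norm (y - z) = norm (x - z)"
  shows "y = x"
proof -
  have xz: "area x z \<noteq> 0" and yz: "area y z \<noteq> 0" using side by auto
  obtain \<alpha> \<beta> where y: "y = \<alpha> *\<^sub>R x + \<beta> *\<^sub>R z" and \<alpha>: "\<alpha> = area y z / area x z"
    using expand_in_basis[OF xz] by metis
  have pos: "\<alpha> > 0" using side unfolding \<alpha> by (auto simp: zero_less_divide_iff zero_less_mult_iff)
  show ?thesis
  proof (cases "\<alpha> \<le> 1")
    case True
    then show ?thesis using same_side_unique_ordered[OF xz pos _ y norms] by simp
  next
    case False
    have "x = (1 / \<alpha>) *\<^sub>R y + (- \<beta> / \<alpha>) *\<^sub>R z" unfolding y using pos by (simp add: algebra_simps)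
    from same_side_unique_ordered[OF yz _ _ this] pos False norms show ?thesis by auto
  qed
qed

text \<open>
  Of the three collinear points \<open>0\<close>, \<open>z\<close>, \<open>x\<close> one lies between the other two, so their distances
  satisfy a triangle equality. A point \<open>y\<close> off the line would satisfy the strict inequality for the
  same distances.
\<close>
lemma on_line_unique:
  assumes z: "z \<noteq> 0" and x: "area x z = 0"
    and norms: "norm y = norm x" "norm (y - z) = norm (x - z)"
  shows "y = x"
proof -
  obtain t where t: "x = t *\<^sub>R z"
    using x area_eq_0_iff_span[OF z] unfolding span_singleton by auto
  have nx: "norm x = \<bar>t\<bar> * norm z" unfolding t by simp
  have "x - z = (t - 1) *\<^sub>R z" unfolding t by (simp add: algebra_simps)
  then have nxz: "norm (x - z) = \<bar>t - 1\<bar> * norm z" by simp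
  have nz: "norm z > 0" using z by simp
  have "area y z = 0"
  proof (rule ccontr)
    assume a: "area y z \<noteq> 0"
    have "norm z < norm y + norm (y - z)" using strict_triangle_diff[of y "y - z"] a by simp
    then have "1 * norm z < (\<bar>t\<bar> + \<bar>t - 1\<bar>) * norm z" unfolding norms nx nxz by (simp add: algebra_simps)
    then have 1: "1 < \<bar>t\<bar> + \<bar>t - 1\<bar>" using nz mult_less_cancel_right_pos by blast
    have "norm y < norm (y - z) + norm z" using strict_triangle[of "y - z" z] a by simp
    then have "\<bar>t\<bar> * norm z < (\<bar>t - 1\<bar> + 1) * norm z" unfolding norms nx nxz by (simp add: algebra_simps)
    then have 2: "\<bar>t\<bar> < \<bar>t - 1\<bar> + 1" using nz mult_less_cancel_right_pos by blast
    have "norm (y - z) < norm y + norm z" using strict_triangle_diff[of y z] a by simp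
    then have "\<bar>t - 1\<bar> * norm z < (\<bar>t\<bar> + 1) * norm z" unfolding norms nx nxz by (simp add: algebra_simps)
    then have 3: "\<bar>t - 1\<bar> < \<bar>t\<bar> + 1" using nz mult_less_cancel_right_pos by blast
    from 1 2 3 show False by linarith
  qed
  then obtain s where s: "y = s *\<^sub>R z"
    using area_eq_0_iff_span[OF z] unfolding span_singleton by auto
  have "\<bar>s\<bar> = \<bar>t\<bar>" using norms(1) nz unfolding nx s by simp
  moreover have "y - z = (s - 1) *\<^sub>R z" unfolding s by (simp add: algebra_simps)
  then have "\<bar>s - 1\<bar> = \<bar>t - 1\<bar>" using norms(2) nz unfolding nxz by simp
  ultimately have "s = t" by linarith
  then show ?thesis using s t by simp
qed

text \<open>
  The intermediate value theorem along the half sphere through the side opposite to \<open>x\<close>.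
\<close>
lemma opposite_side_exists:
  assumes xz: "area x z \<noteq> 0"
  obtains y where "area x z * area y z < 0" "norm y = norm x" "norm (y - z) = norm (x - z)"
proof -
  have z: "z \<noteq> 0" and x: "x \<noteq> 0" using xz by auto
  \<comment> \<open>the broken line from \<open>- z\<close> over \<open>- x\<close> to \<open>z\<close>; \<open>c\<close> projects it radially onto the sphere through \<open>x\<close>\<close>
  define d where "d t = t *\<^sub>R z - (1 - \<bar>t\<bar>) *\<^sub>R x" for t :: real
  have d0: "d t \<noteq> 0" if "t \<in> {-1..1}" for t
  proof
    assume "d t = 0"
    then have "area (d t) z = 0" "area (d t) x = 0" by auto
    then show False using xz area_swap[of z x] unfolding d_def by auto
  qed
  define c where "c t = (norm x / norm (d t)) *\<^sub>R d t" for t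
  have contd: "continuous_on {-1..1} d" unfolding d_def [abs_def] by (intro continuous_intros)
  have contc: "continuous_on {-1..1} c"
    unfolding c_def [abs_def] by (intro continuous_intros contd) (use d0 in auto)
  have nc: "norm (c t) = norm x" if "t \<in> {-1..1}" for t
    unfolding c_def using d0[OF that] by simp
  define g where "g t = norm (c t - z)" for t
  have contg: "continuous_on {-1..1} g" unfolding g_def [abs_def] by (intro continuous_intros contc)
  have "c 1 - z = (norm x / norm z - 1) *\<^sub>R z" unfolding c_def d_def by (simp add: algebra_simps)
  then have "g 1 = \<bar>norm x / norm z - 1\<bar> * norm z" unfolding g_def by simp
  also have "\<dots> = \<bar>(norm x / norm z - 1) * norm z\<bar>" by (simp add: abs_mult)
  also have "\<dots> = \<bar>norm x - norm z\<bar>" using z by (simp add: algebra_simps)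
  finally have g1: "g 1 = \<bar>norm x - norm z\<bar>" .
  have "c (-1) - z = - (norm x / norm z + 1) *\<^sub>R z" unfolding c_def d_def by (simp add: algebra_simps)
  then have "g (-1) = \<bar>- (norm x / norm z + 1)\<bar> * norm z" unfolding g_def by (simp only: norm_scaleR)
  also have "\<dots> = (norm x / norm z + 1) * norm z" by (subst abs_minus_cancel, subst abs_of_nonneg) auto
  also have "\<dots> = norm x + norm z" using z by (simp add: algebra_simps)
  finally have gm1: "g (-1) = norm x + norm z" .
  have "norm (x - z) < norm x + norm z" by (rule strict_triangle_diff[OF xz])
  moreover have "norm x < norm (x - z) + norm z" using strict_triangle[of "x - z" z] xz by simp
  moreover have "norm z < norm x + norm (x - z)" using strict_triangle_diff[of x "x - z"] xz by simp
  \<comment> \<open>the three strict triangle inequalities place the required value strictly between the end values\<close>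
  ultimately have le: "g 1 < norm (x - z)" "norm (x - z) < g (-1)" unfolding g1 gm1 by linarith+
  then obtain t where t: "-1 \<le> t" "t \<le> 1" "g t = norm (x - z)"
    using IVT2'[of g 1 "norm (x - z)" "-1"] contg by auto
  have "t \<noteq> 1" "t \<noteq> -1" using t le by auto
  then have t1: "\<bar>t\<bar> < 1" using t by auto
  have nd: "norm (d t) > 0" using d0 t by auto
  define K where "K = norm x / norm (d t) * (1 - \<bar>t\<bar>)"
  have "K > 0" unfolding K_def using t1 nd x by simp
  have ad: "area (d t) z = - ((1 - \<bar>t\<bar>) * area x z)" unfolding d_def by (simp add: algebra_simps)
  have "area (c t) z = norm x / norm (d t) * area (d t) z" unfolding c_def by simp
  also have "\<dots> = - (K * area x z)" unfolding ad K_def by (simp only: mult_minus_right mult.assoc)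
  finally have "area x z * area (c t) z = - (K * (area x z)\<^sup>2)" by (simp add: power2_eq_square)
  moreover have "K * (area x z)\<^sup>2 > 0" using \<open>K > 0\<close> xz by simp
  ultimately have "area x z * area (c t) z < 0" by linarith
  moreover have "norm (c t) = norm x" by (rule nc) (use t in auto)
  moreover have "norm (c t - z) = norm (x - z)" using t(3) unfolding g_def .
  ultimately show thesis by (rule that)
qed

text \<open>
  If both spheres had the supporting direction \<open>k\<close> at \<open>q\<close>, then \<open>q\<close> would be a point closest to the
  origin on its line parallel to \<open>k\<close>, and \<open>q - z\<close> likewise. A multiple of one of these lines is the
  other, so by strict convexity the closest points correspond, and \<open>q\<close> and \<open>q - z\<close> are collinear.
\<close>
lemma spheres_transversal:
  assumes q: "area q z \<noteq> 0" and k: "k \<noteq> 0"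
    and t1: "\<And>t. norm q \<le> norm (q + t *\<^sub>R k)"
    and t2: "\<And>t. norm (q - z) \<le> norm (q - z + t *\<^sub>R k)"
  shows False
proof -
  \<comment> \<open>a nonzero multiple of \<open>k\<close> is not a shortest vector on its line, which contains \<open>0\<close>\<close>
  have indep: "area p k \<noteq> 0" if p: "p \<noteq> 0" and t: "\<And>t. norm p \<le> norm (p + t *\<^sub>R k)" for p
  proof
    assume "area p k = 0"
    then obtain c where c: "p = c *\<^sub>R k" using area_eq_0_iff_span[OF k] unfolding span_singleton by auto
    have "norm p \<le> 0" using t[of "- c"] c by simp
    then show False using p by simp
  qed
  have q0: "q \<noteq> 0" and qz0: "q - z \<noteq> 0" using q by auto
  have a1: "area q k \<noteq> 0" by (rule indep[OF q0 t1])
  have a2: "area (q - z) k \<noteq> 0" by (rule indep[OF qz0 t2])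
  obtain \<mu> \<nu> where e: "q - z = \<mu> *\<^sub>R q + \<nu> *\<^sub>R k" and \<mu>: "\<mu> = area (q - z) k / area q k"
    using expand_in_basis[OF a1] by metis
  have \<mu>0: "\<mu> \<noteq> 0" using \<mu> a1 a2 by simp
  define \<tau> where "\<tau> = \<nu> / \<mu>"
  have e': "q - z = \<mu> *\<^sub>R (q + \<tau> *\<^sub>R k)" unfolding e \<tau>_def using \<mu>0 by (simp add: algebra_simps)
  have "norm (q - z) \<le> norm (q - z + (- \<nu>) *\<^sub>R k)" by (rule t2)
  also have "q - z + (- \<nu>) *\<^sub>R k = \<mu> *\<^sub>R q" unfolding e by simp
  finally have "\<bar>\<mu>\<bar> * norm (q + \<tau> *\<^sub>R k) \<le> \<bar>\<mu>\<bar> * norm q" unfolding e' by simp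
  then have le: "norm (q + \<tau> *\<^sub>R k) \<le> norm q" using \<mu>0 by simp
  show False
  proof (cases "\<tau> = 0")
    case True
    then have "z = (1 - \<mu>) *\<^sub>R q" using e' by (simp add: algebra_simps)
    then show False using q by simp
  next
    case False
    have "norm (q + (q + \<tau> *\<^sub>R k)) < norm q + norm (q + \<tau> *\<^sub>R k)"
      by (rule strict_triangle) (use False a1 in auto)
    moreover have "q + (q + \<tau> *\<^sub>R k) = 2 *\<^sub>R (q + (\<tau> / 2) *\<^sub>R k)" by (simp add: algebra_simps scaleR_2)
    then have "norm (q + (q + \<tau> *\<^sub>R k)) = 2 * norm (q + (\<tau> / 2) *\<^sub>R k)" by simp
    moreover have "norm q \<le> norm (q + (\<tau> / 2) *\<^sub>R k)" by (rule t1)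
    ultimately show False using le by linarith
  qed
qed

section \<open>The reflection in a strictly convex plane\<close>

lemma second_intersection_opposite:
  assumes xz: "area x z \<noteq> 0" and y: "y \<noteq> x" "norm y = norm x" "norm (y - z) = norm (x - z)"
  shows "area x z * area y z < 0"
proof -
  have z: "z \<noteq> 0" using xz by auto
  have "area y z \<noteq> 0" using on_line_unique[OF z, of y x] y by auto
  moreover have "\<not> area x z * area y z > 0" using same_side_unique[of x z y] y by auto
  ultimately show ?thesis using xz by (simp add: not_less order_less_le)
qed

lemma second_intersection_ex1:
  assumes xz: "area x z \<noteq> 0"
  shows "\<exists>!y. y \<noteq> x \<and> norm y = norm x \<and> norm (y - z) = norm (x - z)"
proof -
  obtain y where y: "area x z * area y z < 0" "norm y = norm x" "norm (y - z) = norm (x - z)"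
    using opposite_side_exists[OF xz] by blast
  show ?thesis
  proof (rule ex1I[of _ y])
    show "y \<noteq> x \<and> norm y = norm x \<and> norm (y - z) = norm (x - z)"
      using y by (auto simp: mult_less_0_iff)
    fix w assume w: "w \<noteq> x \<and> norm w = norm x \<and> norm (w - z) = norm (x - z)"
    then have "area x z * area w z < 0" using second_intersection_opposite[OF xz] by blast
    with y(1) have "area y z * area w z > 0" by (auto simp: mult_less_0_iff zero_less_mult_iff)
    then show "w = y" using same_side_unique[of y z w] w y by simp
  qed
qed

lemma norm_reflection_ex1:
  fixes z :: 'a
  assumes z: "z \<noteq> 0"
  shows "\<exists>!R. norm_reflection z R"
proof -
  define R where "R x = (if x \<in> span {z} then x else THE y. y \<noteq> x \<and> norm y = norm x \<and> norm (y - z) = norm (x - z))" for x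
  have R: "R x \<noteq> x \<and> norm (R x) = norm x \<and> norm (R x - z) = norm (x - z)" if "x \<notin> span {z}" for x
    using theI'[OF second_intersection_ex1[of x z]] that area_eq_0_iff_span[OF z] unfolding R_def by auto
  show ?thesis
  proof (rule ex1I[of _ R])
    show "norm_reflection z R"
      unfolding norm_reflection_def
    proof (intro conjI allI impI)
      fix x y assume x: "x \<notin> span {z}" and y: "y \<noteq> x \<and> norm y = norm x \<and> norm (y - z) = norm (x - z)"
      then show "y = R x" using second_intersection_ex1[of x z] R[OF x] area_eq_0_iff_span[OF z] by blast
    qed (use R in \<open>auto simp: R_def\<close>)
    fix R' assume R': "norm_reflection z R'"
    show "R' = R"
    proof
      fix x show "R' x = R x"
        using R' R[of x] unfolding norm_reflection_def by (cases "x \<in> span {z}") (auto simp: R_def)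
    qed
  qed
qed

text \<open>
  The weak inequality subsumes the case of points on the line, and the strict case would not be a
  closed condition. In this form the graph is visibly closed and symmetric.
\<close>
lemma norm_reflection_graph:
  fixes z :: 'a
  assumes z: "z \<noteq> 0" and R: "norm_reflection z R"
  shows "R x = y \<longleftrightarrow> norm y = norm x \<and> norm (y - z) = norm (x - z) \<and> area x z * area y z \<le> 0"
proof (cases "area x z = 0")
  case True
  then have "R x = x" using R area_eq_0_iff_span[OF z] unfolding norm_reflection_def by blast
  then show ?thesis using on_line_unique[OF z True, of y] True by auto
next
  case False
  then have nx: "x \<notin> span {z}" using area_eq_0_iff_span[OF z] by blast
  have Rx: "R x \<noteq> x" "norm (R x) = norm x" "norm (R x - z) = norm (x - z)"
    using R nx unfolding norm_reflection_def by auto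
  have ne: "y \<noteq> x" if "area x z * area y z \<le> 0"
  proof
    assume "y = x"
    then have "area x z * area x z \<le> 0" using that by simp
    then show False using False by (auto simp: mult_le_0_iff)
  qed
  show ?thesis
  proof
    assume "R x = y"
    then show "norm y = norm x \<and> norm (y - z) = norm (x - z) \<and> area x z * area y z \<le> 0"
      using second_intersection_opposite[OF False Rx] Rx by simp
  next
    assume y: "norm y = norm x \<and> norm (y - z) = norm (x - z) \<and> area x z * area y z \<le> 0"
    with ne have "y \<noteq> x" by blast
    then show "R x = y" using y R nx unfolding norm_reflection_def by blast
  qed
qed

lemma norm_reflection_involution:
  fixes z :: 'a
  assumes z: "z \<noteq> 0" and R: "norm_reflection z R"
  shows "R (R x) = x"
proof -
  have "norm (R x) = norm x \<and> norm (R x - z) = norm (x - z) \<and> area x z * area (R x) z \<le> 0"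
    using norm_reflection_graph[OF z R, of x "R x"] by (rule iffD1) (rule refl)
  then show ?thesis
    by (subst norm_reflection_graph[OF z R]) (simp add: mult.commute)
qed

lemma norm_reflection_opposite:
  fixes z :: 'a
  assumes z: "z \<noteq> 0" and R: "norm_reflection z R" and x: "x \<notin> span {z}"
  shows "area x z * area (R x) z < 0"
  using second_intersection_opposite[of x z "R x"] R x area_eq_0_iff_span[OF z]
  unfolding norm_reflection_def by blast

text \<open>
  The closed graph theorem for maps into compact sets, applied on each ball of the coordinate
  space; bounded sets stay bounded since \<open>R\<close> preserves the norm.
\<close>
lemma norm_reflection_continuous_coordinates:
  fixes z :: 'a
  assumes z: "z \<noteq> 0" and R: "norm_reflection z R"
  shows "continuous_on UNIV (\<lambda>q. coords (R (point q)))"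
proof -
  obtain K where K: "K > 0" "\<And>v. norm (coords v) \<le> norm v * K"
    using bounded_linear.pos_bounded[OF bounded_linear_coords] by blast
  obtain M where M: "M > 0" "\<And>q. norm (point q) \<le> norm q * M"
    using bounded_linear.pos_bounded[OF bounded_linear_point] by blast
  have nR: "norm (R x) = norm x" for x using norm_reflection_graph[OF z R, of x "R x"] by simp
  have cont: "continuous_on (cball 0 n) (\<lambda>q. coords (R (point q)))" if n: "n > 0" for n :: real
  proof (rule continuous_from_closed_graph)
    show "compact (cball (0 :: real \<times> real) (n * M * K))" by simp
    show "(\<lambda>q. coords (R (point q))) \<in> cball 0 n \<rightarrow> cball 0 (n * M * K)"
    proof
      fix q :: "real \<times> real" assume "q \<in> cball 0 n"
      then have "norm q \<le> n" by simp
      have "norm (coords (R (point q))) \<le> norm (point q) * K" using K(2)[of "R (point q)"] nR by simp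
      also have "\<dots> \<le> norm q * M * K" using M(2) K(1) by (intro mult_right_mono) auto
      also have "\<dots> \<le> n * M * K" using \<open>norm q \<le> n\<close> M K by (intro mult_right_mono) auto
      finally show "coords (R (point q)) \<in> cball 0 (n * M * K)" by simp
    qed
    have "(\<lambda>q. (q, coords (R (point q)))) ` cball 0 n =
      (cball 0 n \<times> UNIV) \<inter> {w. norm (point (snd w)) = norm (point (fst w))} \<inter> {w. norm (point (snd w) - z) = norm (point (fst w) - z)}
        \<inter> {w. area (point (fst w)) z * area (point (snd w)) z \<le> 0}" (is "?L = ?G")
    proof (intro set_eqI iffI)
      fix w assume "w \<in> ?L"
      then obtain q where "w = (q, coords (R (point q)))" "q \<in> cball 0 n" by blast
      then show "w \<in> ?G" using norm_reflection_graph[OF z R, of "point q" "R (point q)"] by simp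
    next
      fix w assume G: "w \<in> ?G"
      obtain q q' where w: "w = (q, q')" by (cases w)
      from G w have q: "q \<in> cball 0 n" and
        "norm (point q') = norm (point q) \<and> norm (point q' - z) = norm (point q - z) \<and> area (point q) z * area (point q') z \<le> 0"
        by simp_all
      then have "R (point q) = point q'" using norm_reflection_graph[OF z R, of "point q" "point q'"] by blast
      then have "w = (q, coords (R (point q)))" using w by simp
      then show "w \<in> ?L" using q by blast
    qed
    moreover have "closed ?G"
      by (intro closed_Int closed_Times closed_cball closed_UNIV closed_Collect_eq closed_Collect_le
           continuous_intros continuous_on_compose2[OF continuous_on_point[of UNIV]] continuous_on_area) auto
    ultimately show "closed ((\<lambda>q. (q, coords (R (point q)))) ` cball 0 n)" by simp
  qed
  have "isCont (\<lambda>q. coords (R (point q))) q" for q :: "real \<times> real"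
  proof -
    have "continuous_on (ball 0 (norm q + 1)) (\<lambda>q. coords (R (point q)))"
      by (rule continuous_on_subset[OF cont[of "norm q + 1"]]) (auto intro: add_nonneg_pos)
    then show ?thesis by (simp add: continuous_on_eq_continuous_at)
  qed
  then show ?thesis by (simp add: continuous_at_imp_continuous_on)
qed

lemma norm_reflection_homeomorphism:
  fixes z :: 'a
  assumes z: "z \<noteq> 0" and R: "norm_reflection z R"
  shows "homeomorphism UNIV UNIV R R"
proof -
  have "continuous_on UNIV (\<lambda>x. point (coords (R (point (coords x)))))"
    by (intro continuous_on_compose2[OF continuous_on_point[of UNIV]]
          continuous_on_compose2[OF norm_reflection_continuous_coordinates[OF z R]] continuous_on_coords) auto
  then have "continuous_on UNIV R" by simp
  moreover have "R ` UNIV = UNIV" using norm_reflection_involution[OF z R] by (metis surjI)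
  ultimately show ?thesis
    unfolding homeomorphism_def using norm_reflection_involution[OF z R] by auto
qed

text \<open>
  The function \<open>area _ z\<close> has opposite signs at \<open>x\<close> and \<open>R x\<close>, so it vanishes somewhere on
  every connected set that contains both.
\<close>
lemma norm_reflection_other_component:
  fixes z :: 'a
  assumes z: "z \<noteq> 0" and R: "norm_reflection z R" and x: "x \<notin> span {z}"
  shows "\<not> connected_component (UNIV - span {z}) x (R x)"
proof
  assume "connected_component (UNIV - span {z}) x (R x)"
  then obtain T where T: "connected T" "T \<subseteq> UNIV - span {z}" "x \<in> T" "R x \<in> T"
    unfolding connected_component_def by blast
  have "connected ((\<lambda>y. area y z) ` T)"
    by (rule connected_continuous_image[OF _ T(1)]) (intro continuous_on_area continuous_intros)
  then have "is_interval ((\<lambda>y. area y z) ` T)" by (simp add: is_interval_connected_1)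
  moreover have "area x z < 0 \<and> 0 < area (R x) z \<or> area (R x) z < 0 \<and> 0 < area x z"
    using norm_reflection_opposite[OF z R x] by (auto simp: mult_less_0_iff)
  ultimately have "0 \<in> (\<lambda>y. area y z) ` T"
    using T(3,4) unfolding is_interval_1 by (meson imageI less_imp_le)
  then show False using T(2) area_eq_0_iff_span[OF z] by force
qed

end

section \<open>Planes with an analytic norm\<close>

text \<open>
  A convex function lies above its tangents.
\<close>
lemma norm_ge_of_flat_direction:
  fixes q k :: "'a::real_normed_vector"
  assumes "((\<lambda>t. norm (q + t *\<^sub>R k)) has_real_derivative 0) (at 0)"
  shows "norm q \<le> norm (q + t *\<^sub>R k)"
proof -
  have "convex_on UNIV (\<lambda>t. norm (q + t *\<^sub>R k))"
  proof (rule convex_onI)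
    fix s x y :: real assume s: "0 < s" "s < 1"
    have "q + ((1 - s) *\<^sub>R x + s *\<^sub>R y) *\<^sub>R k = (1 - s) *\<^sub>R (q + x *\<^sub>R k) + s *\<^sub>R (q + y *\<^sub>R k)"
      by (simp add: algebra_simps)
    then have "norm (q + ((1 - s) *\<^sub>R x + s *\<^sub>R y) *\<^sub>R k) \<le> norm ((1 - s) *\<^sub>R (q + x *\<^sub>R k)) + norm (s *\<^sub>R (q + y *\<^sub>R k))"
      by (metis norm_triangle_ineq)
    then show "norm (q + ((1 - s) *\<^sub>R x + s *\<^sub>R y) *\<^sub>R k) \<le> (1 - s) * norm (q + x *\<^sub>R k) + s * norm (q + y *\<^sub>R k)"
      using s by simp
  qed auto
  from convex_on_imp_above_tangent[OF this, of 0 t 0] assms show ?thesis by simp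
qed

locale analytic_plane = plane_basis b1 b2
  for b1 b2 :: "'a::real_normed_vector" +
  assumes analytic_norm: "real_analytic_wrt {b1, b2} (UNIV - {0}) (norm :: 'a \<Rightarrow> real)"
begin

lemma norm_extends: "q \<noteq> 0 \<Longrightarrow> extends_holomorphically_at (\<lambda>q. norm (point q)) q"
  using real_analytic_extends[OF analytic_norm, of "point q"] linear_0[OF linear_coords] coords_point[of q]
  by fastforce

text \<open>
  Equality in the triangle inequality for \<open>u\<close> and \<open>v\<close> persists for all nonnegative combinations, so
  the norm is $1$ on the segment between the normalised vectors. By the identity theorem it would be
  $1$ on the whole line through them, which avoids the origin; but the norm is unbounded on a line.
\<close>
lemma strict_triangle_analytic:
  assumes uv: "area u v \<noteq> 0"
  shows "norm (u + v) < norm u + norm v"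
proof (rule ccontr)
  assume "\<not> ?thesis"
  then have eq: "norm (u + v) = norm u + norm v" using norm_triangle_ineq[of u v] by linarith
  have u: "u \<noteq> 0" and v: "v \<noteq> 0" using uv by auto
  have add: "norm (s *\<^sub>R u + t *\<^sub>R v) = s * norm u + t * norm v" if st: "0 \<le> s" "0 \<le> t" for s t
  proof (rule antisym)
    show "norm (s *\<^sub>R u + t *\<^sub>R v) \<le> s * norm u + t * norm v"
      using norm_triangle_ineq[of "s *\<^sub>R u" "t *\<^sub>R v"] st by simp
    show "s * norm u + t * norm v \<le> norm (s *\<^sub>R u + t *\<^sub>R v)"
    proof (cases "t \<le> s")
      case True
      have "s *\<^sub>R (u + v) = (s *\<^sub>R u + t *\<^sub>R v) + (s - t) *\<^sub>R v" by (simp add: algebra_simps)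
      then have "norm (s *\<^sub>R (u + v)) \<le> norm (s *\<^sub>R u + t *\<^sub>R v) + norm ((s - t) *\<^sub>R v)" by (metis norm_triangle_ineq)
      then have "s * norm (u + v) \<le> norm (s *\<^sub>R u + t *\<^sub>R v) + (s - t) * norm v" using st True by simp
      then show ?thesis unfolding eq by (simp add: algebra_simps)
    next
      case False
      have "t *\<^sub>R (u + v) = (s *\<^sub>R u + t *\<^sub>R v) + (t - s) *\<^sub>R u" by (simp add: algebra_simps)
      then have "norm (t *\<^sub>R (u + v)) \<le> norm (s *\<^sub>R u + t *\<^sub>R v) + norm ((t - s) *\<^sub>R u)" by (metis norm_triangle_ineq)
      then have "t * norm (u + v) \<le> norm (s *\<^sub>R u + t *\<^sub>R v) + (t - s) * norm u" using st False by simp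
      then show ?thesis unfolding eq by (simp add: algebra_simps)
    qed
  qed
  define p where "p = (1 / norm u) *\<^sub>R u"
  define q where "q = (1 / norm v) *\<^sub>R v - (1 / norm u) *\<^sub>R u"
  have pq: "area p q \<noteq> 0" unfolding p_def q_def using uv u v by simp
  have line_ne: "p + t *\<^sub>R q \<noteq> 0" for t
  proof
    assume "p + t *\<^sub>R q = 0"
    then have "area (p + t *\<^sub>R q) q = 0" by simp
    then show False using pq by simp
  qed
  have line: "point (coords p + t *\<^sub>R coords q) = p + t *\<^sub>R q" for t
    by (simp add: linear_add[OF linear_point] linear_scale[OF linear_point])
  have "norm (point (coords p + t *\<^sub>R coords q)) = 1" for t
  proof (rule extends_constant_on_line)
    fix t
    show "extends_holomorphically_at (\<lambda>q. norm (point q)) (coords p + t *\<^sub>R coords q)"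
    proof (rule norm_extends)
      show "coords p + t *\<^sub>R coords q \<noteq> 0"
        using line_ne[of t] line[of t] linear_0[OF linear_point] by metis
    qed
  next
    fix t :: real assume t: "t \<in> {0<..<1}"
    have "p + t *\<^sub>R q = ((1 - t) / norm u) *\<^sub>R u + (t / norm v) *\<^sub>R v"
      unfolding p_def q_def by (simp add: algebra_simps diff_divide_distrib)
    then have "norm (p + t *\<^sub>R q) = 1" using add[of "(1 - t) / norm u" "t / norm v"] t u v by simp
    then show "norm (point (coords p + t *\<^sub>R coords q)) = 1" unfolding line .
  qed (rule zero_less_one)
  then have one: "norm (p + t *\<^sub>R q) = 1" for t unfolding line by simp
  have q0: "norm q > 0" using pq by auto
  \<comment> \<open>two vectors of norm \<open>1\<close> on the line at distance \<open>3\<close> from each other\<close>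
  have "(3 / norm q) *\<^sub>R q = (p + (3 / norm q) *\<^sub>R q) - (p + 0 *\<^sub>R q)" by simp
  then have "norm ((3 / norm q) *\<^sub>R q) \<le> norm (p + (3 / norm q) *\<^sub>R q) + norm (p + 0 *\<^sub>R q)"
    by (metis norm_triangle_ineq4)
  then show False using q0 unfolding one by simp
qed

sublocale strictly_convex_plane
  by unfold_locales (rule strict_triangle_analytic)

text \<open>
  A singular Jacobian has a kernel vector, and in that direction both norms have derivative zero. By
  convexity both spheres are then supported by it, contradicting transversality.
\<close>
lemma jacobian_nonzero:
  assumes q: "area q z \<noteq> 0"
    and d1: "((\<lambda>x. norm (point x)) has_derivative (\<lambda>h. a1 * fst h + b1' * snd h)) (at (coords q))"
    and d2: "((\<lambda>x. norm (point (x - coords z))) has_derivative (\<lambda>h. a2 * fst h + b2' * snd h)) (at (coords q))"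
  shows "a1 * b2' - b1' * a2 \<noteq> 0"
proof
  assume det: "a1 * b2' - b1' * a2 = 0"
  have "\<exists>h. h \<noteq> 0 \<and> a1 * fst h + b1' * snd h = 0 \<and> a2 * fst h + b2' * snd h = 0"
  proof (cases "a1 = 0 \<and> b1' = 0")
    case False
    \<comment> \<open>a nonzero row, rotated by a right angle, is annihilated by both rows\<close>
    then show ?thesis using det by (intro exI[of _ "(- b1', a1)"]) (auto simp: algebra_simps zero_prod_def)
  next
    case True
    show ?thesis
    proof (cases "a2 = 0 \<and> b2' = 0")
      case False
      then show ?thesis using True by (intro exI[of _ "(- b2', a2)"]) (auto simp: algebra_simps zero_prod_def)
    next
      case z: True
      then show ?thesis using True by (intro exI[of _ "(1, 0)"]) (auto simp: zero_prod_def)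
    qed
  qed
  then obtain h where h: "h \<noteq> 0" "a1 * fst h + b1' * snd h = 0" "a2 * fst h + b2' * snd h = 0" by blast
  have flat: "((\<lambda>t. f (coords q + t *\<^sub>R h)) has_real_derivative 0) (at 0)"
    if f: "(f has_derivative (\<lambda>h. a * fst h + b * snd h)) (at (coords q))" and ab: "a * fst h + b * snd h = 0"
    for f :: "real \<times> real \<Rightarrow> real" and a b
  proof -
    have 1: "((\<lambda>t. coords q + t *\<^sub>R h) has_derivative (\<lambda>t. t *\<^sub>R h)) (at 0)"
      by (auto intro!: derivative_eq_intros)
    have "((\<lambda>t. f (coords q + t *\<^sub>R h)) has_derivative (\<lambda>t. a * fst (t *\<^sub>R h) + b * snd (t *\<^sub>R h))) (at 0)"
      by (rule has_derivative_compose[OF 1]) (simp add: f)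
    moreover have "(\<lambda>t. a * fst (t *\<^sub>R h) + b * snd (t *\<^sub>R h)) = (*) 0"
    proof
      fix t
      have "a * fst (t *\<^sub>R h) + b * snd (t *\<^sub>R h) = t * (a * fst h + b * snd h)" by (simp add: algebra_simps)
      then show "a * fst (t *\<^sub>R h) + b * snd (t *\<^sub>R h) = 0 * t" using ab by simp
    qed
    ultimately show ?thesis unfolding has_field_derivative_def by simp
  qed
  define k where "k = point h"
  have "coords k \<noteq> 0" using h(1) unfolding k_def by simp
  then have k: "k \<noteq> 0" using linear_0[OF linear_coords] by metis
  have "((\<lambda>t. norm (q + t *\<^sub>R k)) has_real_derivative 0) (at 0)"
    using flat[OF d1 h(2)] by (simp add: k_def linear_add[OF linear_point] linear_scale[OF linear_point])
  moreover have "((\<lambda>t. norm (q - z + t *\<^sub>R k)) has_real_derivative 0) (at 0)"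
    using flat[OF d2 h(3)]
    by (simp add: k_def linear_add[OF linear_point] linear_diff[OF linear_point] linear_scale[OF linear_point] algebra_simps)
  ultimately show False
    using spheres_transversal[OF q k] norm_ge_of_flat_direction by blast
qed

text \<open>
  The two equations that define \<open>R\<close> have the same two functions on both sides, namely the distances to
  \<open>0\<close> and to \<open>z\<close>. Their Jacobian matters only at \<open>R x\<close>, where the system is solved.
\<close>
lemma norm_reflection_extends:
  fixes z :: 'a
  assumes z: "z \<noteq> 0" and R: "norm_reflection z R" and x: "x \<notin> span {z}"
  shows "extends_holomorphically_at (\<lambda>q. fst (coords (R (point q)))) (coords x)"
    "extends_holomorphically_at (\<lambda>q. snd (coords (R (point q)))) (coords x)"
proof -
  have ax: "area x z \<noteq> 0" and aR: "area (R x) z \<noteq> 0"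
    using norm_reflection_opposite[OF z R x] by auto
  have ext: "extends_holomorphically_at (\<lambda>q. norm (point q)) (coords y)"
     "extends_holomorphically_at (\<lambda>q. norm (point (q - coords z))) (coords y)" if y: "area y z \<noteq> 0" for y
  proof -
    have "coords y \<noteq> 0" "coords y - coords z \<noteq> 0" using y unfolding area_def by auto
    then show "extends_holomorphically_at (\<lambda>q. norm (point q)) (coords y)"
       "extends_holomorphically_at (\<lambda>q. norm (point (q - coords z))) (coords y)"
      using norm_extends extends_holomorphically_shift[of "\<lambda>q. norm (point q)"] by blast+
  qed
  obtain a1 b1' where d1: "((\<lambda>x. norm (point x)) has_derivative (\<lambda>h. a1 * fst h + b1' * snd h)) (at (coords (R x)))"
    by (rule extends_holomorphically_has_derivative[OF ext(1)[OF aR]]) (rule that)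
  obtain a2 b2' where d2: "((\<lambda>x. norm (point (x - coords z))) has_derivative (\<lambda>h. a2 * fst h + b2' * snd h)) (at (coords (R x)))"
    by (rule extends_holomorphically_has_derivative[OF ext(2)[OF aR]]) (rule that)
  note det = jacobian_nonzero[OF aR d1 d2]
  define R' where "R' q = coords (R (point q))" for q
  have R'x: "R' (coords x) = coords (R x)" unfolding R'_def by simp
  have cont: "isCont R' (coords x)"
    using norm_reflection_continuous_coordinates[OF z R] continuous_on_eq_continuous_at[OF open_UNIV]
    unfolding R'_def [abs_def] by blast
  have "norm (point (R' q)) = norm (point q)" "norm (point (R' q - coords z)) = norm (point (q - coords z))" for q
    using norm_reflection_graph[OF z R, of "point q" "R (point q)"]
    unfolding R'_def by (simp_all add: linear_diff[OF linear_point])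
  then have eq: "\<forall>\<^sub>F q in nhds (coords x). norm (point (R' q)) = norm (point q) \<and> norm (point (R' q - coords z)) = norm (point (q - coords z))"
    by simp
  from analytic_implicit_pair[OF ext[OF ax] ext[OF aR, folded R'x] d1[folded R'x] d2[folded R'x] det cont eq]
  show "extends_holomorphically_at (\<lambda>q. fst (coords (R (point q)))) (coords x)"
    "extends_holomorphically_at (\<lambda>q. snd (coords (R (point q)))) (coords x)"
    unfolding R'_def .
qed

lemma norm_reflection_differentiable:
  fixes z :: 'a
  assumes z: "z \<noteq> 0" and R: "norm_reflection z R" and x: "x \<notin> span {z}"
  shows "\<exists>D. (R has_derivative D) (at x)"
proof -
  obtain a1 c1 where d1: "((\<lambda>q. fst (coords (R (point q)))) has_derivative (\<lambda>h. a1 * fst h + c1 * snd h)) (at (coords x))"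
    by (rule extends_holomorphically_has_derivative[OF norm_reflection_extends(1)[OF z R x]]) (rule that)
  obtain a2 c2 where d2: "((\<lambda>q. snd (coords (R (point q)))) has_derivative (\<lambda>h. a2 * fst h + c2 * snd h)) (at (coords x))"
    by (rule extends_holomorphically_has_derivative[OF norm_reflection_extends(2)[OF z R x]]) (rule that)
  have "((\<lambda>q. coords (R (point q))) has_derivative (\<lambda>h. (a1 * fst h + c1 * snd h, a2 * fst h + c2 * snd h))) (at (coords x))"
    using has_derivative_Pair[OF d1 d2] by simp
  from has_derivative_compose[OF bounded_linear_imp_has_derivative[OF bounded_linear_coords] this]
  have "((\<lambda>y. coords (R (point (coords y)))) has_derivative
     (\<lambda>h. (a1 * fst (coords h) + c1 * snd (coords h), a2 * fst (coords h) + c2 * snd (coords h)))) (at x)" .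
  from bounded_linear.has_derivative[OF bounded_linear_point this] show ?thesis by auto
qed

text \<open>
  The chain rule for $R \circ R = \mathrm{id}$ exhibits the derivative at \<open>R x\<close> as a left inverse of the
  derivative at \<open>x\<close>.
\<close>
lemma norm_reflection_analytic_immersion:
  fixes z :: 'a
  assumes z: "z \<noteq> 0" and R: "norm_reflection z R"
  shows "analytic_immersion_on (UNIV - span {z}) R"
  unfolding analytic_immersion_on_def
proof (intro conjI ballI)
  have "real_analytic_wrt {b1, b2} (UNIV - span {z}) R"
    by (rule real_analytic_wrtI_extends) (simp_all add: norm_reflection_extends[OF z R])
  then show "real_analytic_on (UNIV - span {z}) R"
    unfolding real_analytic_on_def using basis_independent basis_span
    by (intro exI[of _ "{b1, b2}"] conjI) auto
  fix x assume "x \<in> UNIV - span {z}"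
  then have x: "x \<notin> span {z}" by simp
  then have Rx: "R x \<notin> span {z}"
    using norm_reflection_opposite[OF z R x] area_eq_0_iff_span[OF z, of "R x"] by auto
  obtain D where D: "(R has_derivative D) (at x)" using norm_reflection_differentiable[OF z R x] ..
  obtain E where E: "(R has_derivative E) (at (R x))" using norm_reflection_differentiable[OF z R Rx] ..
  have "((\<lambda>y. R (R y)) has_derivative (\<lambda>h. E (D h))) (at x)" by (rule has_derivative_compose[OF D E])
  then have "((\<lambda>y. y) has_derivative (\<lambda>h. E (D h))) (at x)"
    by (simp add: norm_reflection_involution[OF z R])
  from has_derivative_unique[OF this has_derivative_ident] have "E (D h) = h" for h by (rule fun_cong)
  then have "inj D" by (rule inj_on_inverseI)
  with D show "\<exists>D. (R has_derivative D) (at x) \<and> inj D" by blast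
qed

end

theorem theorem4p3:
  fixes z :: "'a::real_normed_vector"
  assumes "dim (UNIV :: 'a set) = 2"
    and "real_analytic_on (UNIV - {0}) (norm :: 'a \<Rightarrow> real)"
    and "\<not> comes_from_inner_product (norm :: 'a \<Rightarrow> real)"
    and "z \<noteq> 0"
  shows "(\<exists>!R. norm_reflection z R) \<and>
    (\<forall>R. norm_reflection z R \<longrightarrow>
      (\<exists>R'. homeomorphism UNIV UNIV R R') \<and>
      analytic_immersion_on (UNIV - span {z}) R \<and>
      (\<forall>x. x \<notin> span {z} \<longrightarrow> \<not> connected_component (UNIV - span {z}) x (R x)) \<and>
      (\<forall>x y. x \<in> span {z} \<and> norm y = norm x \<and> norm (y - z) = norm (x - z) \<longrightarrow> y = x))"
proof -
  obtain B :: "'a set" where B: "finite B" "independent B" "span B = UNIV" "real_analytic_wrt B (UNIV - {0}) (norm :: 'a \<Rightarrow> real)"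
    using assms(2) unfolding real_analytic_on_def by blast
  have "card B = 2" using dim_eq_card_independent[OF B(2)] dim_span[of B] B(3) assms(1) by simp
  then obtain b1 b2 where b: "B = {b1, b2}" "b1 \<noteq> b2" by (auto simp: card_2_iff)
  interpret analytic_plane b1 b2
    by unfold_locales (use B b in auto)
  show ?thesis
  proof (intro conjI allI impI)
    show "\<exists>!R. norm_reflection z R" by (rule norm_reflection_ex1[OF assms(4)])
  next
    fix R assume R: "norm_reflection z R"
    show "\<exists>R'. homeomorphism UNIV UNIV R R'" using norm_reflection_homeomorphism[OF assms(4) R] by blast
    show "analytic_immersion_on (UNIV - span {z}) R" by (rule norm_reflection_analytic_immersion[OF assms(4) R])
    show "\<not> connected_component (UNIV - span {z}) x (R x)" if "x \<notin> span {z}" for x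
      by (rule norm_reflection_other_component[OF assms(4) R that])
  next
    fix x y assume "x \<in> span {z} \<and> norm y = norm x \<and> norm (y - z) = norm (x - z)"
    then show "y = x" using on_line_unique[OF assms(4), of x y] area_eq_0_iff_span[OF assms(4)] by simp
  qed
qed

end
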